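(* Let $\mathfrak{S}=(\mathfrak{A},\mathfrak{B},\mathfrak{C})$ be an impedance passive port-Hamiltonian system of order $N\ge1$ and let $M_c:D(M_c)\subseteq X_c\times\mathbb{K}^{Nd}\rightrightarrows X_c\times\mathbb{K}^{Nd}$ be an m-dissipative map satisfying the controller assumption (see context) with orthogonal projection $\Pi:\mathbb{K}^{Nd}\to\mathbb{K}^{Nd}$. Denote by $(\mathcal{S}(t))_{t\ge0}$ the nonlinear strongly continuous contraction semigroup on $X\times\underline{X}_c$ generated by the interconnected (m-dissipative) map $\mathcal{A}$. Suppose there are $q:X\to\mathbb{R}$ and constants $\hat c,c>0$ such that $|q(x)|\le\hat c\|x\|_{\mathcal{H}}^2$ for all $x\in X$, and such that for all solutions $x\in W^1_\infty(\mathbb{R}_+;X)\cap L_\infty(\mathbb{R}_+;D(\mathfrak{A}))$ of $\dot x=\mathfrak{A}x$ one has $q(x)\in W^1_\infty(\mathbb{R}_+)$ and $$\|x(t)\|_{\mathcal{H}}^2+\frac{d}{dt}q(x(t))\le c\left(|\mathfrak{B}x(t)|^2+|\Pi\mathfrak{C}x(t)|^2\right)\qquad\text{for a.e. }t\ge0.$$ Then $0$ is a globally uniformly exponentially stable equilibrium of $(\mathcal{S}(t))_{t\ge0}$, i.e. there are $M\ge1$, $\omega<0$ such that $\|\mathcal{S}(t)z\|_{X\times X_c}\le Me^{\omega t}\|z\|_{X\times X_c}$ for all $z\in X\times\underline{X}_c$, $t\ge0$.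
   Context: $\mathbb{K}=\mathbb{R}$ or $\mathbb{C}$, $\mathbb{R}_+=[0,\infty)$. Multi-valued maps. For a Hilbert space $Z$, a map $A:Z\to\mathcal{P}(Z)$, written $A:D(A)\subseteq Z\rightrightarrows Z$, has domain $D(A)=\{x:A(x)\ne\emptyset\}$. $A$ is dissipative if $\mathrm{Re}\,(y-y'\mid x-x')_Z\le 0$ for all $x,x'\in D(A)$, $y\in A(x)$, $y'\in A(x')$; it is m-dissipative if moreover $\bigcup_{x\in D(A)}(x-A(x))=Z$. Semigroups. A strongly continuous contraction semigroup on a closed set $Z_0\subseteq Z$ is a family of maps $S(t):Z_0\to Z_0$, $t\ge0$ (possibly nonlinear), with $S(0)=I$, $S(t+s)=S(t)S(s)$, $\|S(t)x-S(t)x'\|_Z\le\|x-x'\|_Z$, and $t\mapsto S(t)x$ continuous on $[0,\infty)$ for every $x\in Z_0$. $A$ generates such a semigroup on $Z_0=\overline{D(A)}$ if for each $x_0\in D(A)$ the function $x(t)=S(t)x_0$ is the unique absolutely continuous solution (and it is Lipschitz continuous) of $\frac{d}{dt}x(t)\in A(x(t))$ for a.e. $t\ge0$, $x(0)=x_0$. Port-Hamiltonian system of order $N$. Let $N,d\ge1$, $P_0,\dots,P_N\in\mathbb{K}^{d\times d}$ with $P_k^*=(-1)^{k+1}P_k$ for $k=1,\dots,N$, $P_N$ invertible, $\mathrm{Re}\,P_0:=\frac12(P_0+P_0^* )\le0$. Let $\mathcal{H}\in L_\infty(0,1;\mathbb{K}^{d\times d})$ have self-adjoint values with $z^*\mathcal{H}(\zeta)z\ge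 m_0|z|^2$ for some $m_0>0$, all $z\in\mathbb{K}^d$ and a.e. $\zeta$. Let $X=L_2(0,1;\mathbb{K}^d)$ with inner product $(x\mid y)_{\mathcal{H}}=(x\mid\mathcal{H}y)_{L_2}$ and norm $\|\cdot\|_{\mathcal{H}}$. Define $\mathfrak{A}x=\sum_{k=0}^N P_k(\mathcal{H}x)^{(k)}$ on $D(\mathfrak{A})=\{x\in X:\mathcal{H}x\in H^N(0,1)^d\}$ (with graph norm). The boundary variables $f_\partial,e_\partial\in\mathbb{K}^{Nd}$ are $$\begin{pmatrix} f_{\partial} \\ e_{\partial} \end{pmatrix}=\frac1{\sqrt2}\begin{bmatrix} Q&-Q \\ I&I \end{bmatrix}\big((\mathcal{H}x)(1),\dots,(\mathcal{H}x)^{(N-1)}(1),(\mathcal{H}x)(0),\dots,(\mathcal{H}x)^{(N-1)}(0)\big)^T,$$ where $Q\in\mathbb{K}^{Nd\times Nd}$ is the block matrix with $(i,j)$ block $(-1)^{i-1}P_{i+j-1}$ if $i+j-1\le N$ and $0$ otherwise. Given $W_B,W_C\in\mathbb{K}^{Nd\times2Nd}$ with $\begin{bmatrix} W_B \\ W_C \end{bmatrix}$ invertible, set $\mathfrak{B}x=W_B\begin{pmatrix} f_\partial \\ e_\partial \end{pmatrix}$, $\mathfrak{C}x=W_C\begin{pmatrix} f_\partial \\ e_\partial \end{pmatrix}$. The system is $\mathfrak{S}=(\mathfrak{A},\mathfrak{B},\mathfrak{C})$; it is impedance passive if $\mathrm{Re}\,(\mathfrak{A}x\mid x)_{\mathcal{H}}\le\mathrm{Re}\,(\mathfrak{B}x\mid\mathfrak{C}x)_{\mathbb{K}^{Nd}}$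 for all $x\in D(\mathfrak{A})$. Interconnection. $X_c$ is a Hilbert space and $M_c$ is m-dissipative on $X_c\times\mathbb{K}^{Nd}$ (sum inner product). $\Pi_{X_c}$ is the canonical projection onto $X_c$, $\underline{X}_c:=\overline{\Pi_{X_c}D(M_c)}$. The interconnected map on $X\times X_c$ (sum of $(\cdot\mid\cdot)_{\mathcal{H}}$ and $(\cdot\mid\cdot)_{X_c}$) is $\mathcal{A}(x,x_c)=\{(\mathfrak{A}x,z_c):(z_c,\mathfrak{B}x)\in M_c(x_c,\mathfrak{C}x)\}$, with domain $D(\mathcal{A})$ the set of $(x,x_c)\in D(\mathfrak{A})\times X_c$ for which this set is nonempty. It is known that $\mathcal{A}$ is m-dissipative with $\overline{D(\mathcal{A})}=X\times\underline{X}_c$. Controller assumption. $0\in M_c(0)$, and there are $\rho>0$ and an orthogonal projection $\Pi:\mathbb{K}^{Nd}\to\mathbb{K}^{Nd}$ onto some subspace such that: (1) $\mathrm{Re}\,((z_c,y_c)\mid(x_c,u_c))_{X_c\times\mathbb{K}^{Nd}}\le-\rho(\|x_c\|_{X_c}^2+|\Pi u_c|^2)$ for all $(x_c,u_c)\in D(M_c)$, $(z_c,y_c)\in M_c(x_c,u_c)$; (2) there is $c'>0$ such that $|y_c|^2\le c'(\|x_c\|_{X_c}^2+|\Pi u_c|^2)$ whenever $(z_c,-y_c)\in M_c(x_c,u_c)$; (3) there are $t_0,\delta,c_0>0$ such that every mild solution of the control system $(\dot x_c(t),-y_c(t))\in M_c(x_c(t),u_c(t))$ satisfies $\|x_c(t_0)\|_{X_c}^2\le(1-\delta)\|x_c(0)\|_{X_c}^2+c_0\|\Pi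 u_c\|_{L_2(0,t_0)}^2$. Here a strong solution on $[0,t_0]$ is a triple of an absolutely continuous $x_c$ and $u_c,y_c\in L_2(0,t_0;\mathbb{K}^{Nd})$ satisfying the inclusion a.e.; a mild solution is a limit of strong solutions, with $x_c$ converging in $C([0,t_0];X_c)$ and $u_c$ in $L_2(0,t_0;\mathbb{K}^{Nd})$. *)

theory Defs
  imports "HOL-Analysis.Analysis"
begin

section \<open>Real or complex scalars\<close>

text \<open>
  The scalars are a type of class \<open>RC_field\<close>.  Its only members are, up to isometric
  isomorphism, the real and the complex numbers: see \<open>RC_field_cases\<close> below.
\<close>

class RC_field = real_normed_field + euclidean_space

instance real :: RC_field ..
instance complex :: RC_field ..

definition kre :: "'k::RC_field \<Rightarrow> real" where
  "kre z = inner z 1"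

definition kcnj :: "'k::RC_field \<Rightarrow> 'k" where
  "kcnj z = 2 * of_real (kre z) - z"

lemma kre_real: "kre (r::real) = r"
  by (simp add: kre_def)

lemma kcnj_real: "kcnj (r::real) = r"
  by (simp add: kcnj_def kre_real)

lemma kre_complex: "kre z = Re z"
  by (simp add: kre_def inner_complex_def)

lemma kcnj_complex: "kcnj z = cnj z"
  by (simp add: kcnj_def kre_complex complex_eq_iff)

lemma RC_field_inner_1_1: "inner 1 (1::'k::RC_field) = 1"
  by (simp flip: power2_norm_eq_inner)

lemma RC_field_imaginary_unit:
  fixes u :: "'k::RC_field"
  assumes u: "inner u 1 = 0" "norm u = 1"
  shows "u * u = -1"
proof -
  have 1: "norm (1 + u) ^ 2 = 2" "norm (1 - u) ^ 2 = 2"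
    using u by (simp_all add: power2_norm_eq_inner norm_eq_1 inner_add_left inner_add_right
        inner_diff_left inner_diff_right inner_commute RC_field_inner_1_1)
  have "norm (1 - u * u) ^ 2 = (norm (1 + u) * norm (1 - u)) ^ 2"
    by (simp add: algebra_simps flip: norm_mult)
  also have "\<dots> = 4" using 1 by (simp add: power_mult_distrib)
  finally have "norm (1 - u * u) ^ 2 = 4" .
  moreover have "norm (u * u) = 1" using u by (simp add: norm_mult)
  ultimately have "inner (u * u) 1 = -1"
    by (simp add: power2_norm_eq_inner inner_diff_left inner_diff_right inner_commute norm_eq_1 RC_field_inner_1_1)
  then have "norm (u * u + 1) ^ 2 = 0"
    using \<open>norm (u * u) = 1\<close>
    by (simp add: power2_norm_eq_inner inner_add_left inner_add_right inner_commute norm_eq_1 RC_field_inner_1_1)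
  then show ?thesis by (simp add: add_eq_0_iff2)
qed

lemma RC_field_cases:
  "(\<forall>z::'k::RC_field. z = of_real (kre z)) \<or>
   (\<exists>u::'k. u * u = -1 \<and> inner u 1 = 0 \<and> norm u = 1 \<and>
     (\<forall>z. \<exists>b. z = of_real (kre z) + of_real b * u))"
proof (rule disjCI)
  assume no: "\<not> (\<exists>u::'k. u * u = -1 \<and> inner u 1 = 0 \<and> norm u = 1 \<and>
     (\<forall>z. \<exists>b. z = of_real (kre z) + of_real b * u))"
  show "\<forall>z::'k. z = of_real (kre z)"
  proof (rule ccontr)
    have orth: "inner (z - of_real (kre z)) 1 = 0" for z :: 'k
      by (simp add: kre_def inner_diff_left of_real_def RC_field_inner_1_1)
    define nrm where "nrm z = (1 / norm (z - of_real (kre z))) *\<^sub>R (z - of_real (kre z))" for z :: 'k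
    have nrm: "nrm z * nrm z = -1" "inner (nrm z) 1 = 0" "norm (nrm z) = 1"
      if "z \<noteq> of_real (kre z)" for z :: 'k
    proof -
      show 1: "inner (nrm z) 1 = 0" using orth[of z] by (simp add: nrm_def)
      show 2: "norm (nrm z) = 1" using that by (simp add: nrm_def)
      show "nrm z * nrm z = -1" by (rule RC_field_imaginary_unit[OF 1 2])
    qed
    assume "\<not> (\<forall>z::'k. z = of_real (kre z))"
    then obtain w :: 'k where w: "w \<noteq> of_real (kre w)" by blast
    define u where "u = nrm w"
    note u = nrm[OF w, folded u_def]
    have "\<exists>b. z = of_real (kre z) + of_real b * u" for z :: 'k
    proof (cases "z = of_real (kre z)")
      case True
      then show ?thesis by (intro exI[of _ 0]) simp
    next
      case False
      have "(nrm z - u) * (nrm z + u) = 0"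
        using nrm(1)[OF False] u(1) by (simp add: algebra_simps)
      then have "nrm z = u \<or> nrm z = - u" by (auto simp: add_eq_0_iff2)
      moreover have "z - of_real (kre z) = of_real (norm (z - of_real (kre z))) * nrm z"
        using False by (simp add: nrm_def of_real_def[symmetric] scaleR_conv_of_real)
      ultimately have "z - of_real (kre z) = of_real (norm (z - of_real (kre z))) * u
          \<or> z - of_real (kre z) = of_real (- norm (z - of_real (kre z))) * u"
        by auto
      then show ?thesis by (metis add.commute diff_add_cancel)
    qed
    with u no show False by blast
  qed
qed

text \<open>Inner products are conjugate-linear in the first argument.\<close>

definition kip :: "'k::RC_field ^ 'i \<Rightarrow> 'k ^ 'i \<Rightarrow> 'k" where
  "kip x y = (\<Sum>i\<in>UNIV. kcnj (x $ i) * y $ i)"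

definition kadj :: "'k::RC_field ^ 'i ^ 'j \<Rightarrow> 'k ^ 'j ^ 'i" where
  "kadj A = (\<chi> i j. kcnj (A $ j $ i))"

definition orthogonal_projection :: "('k::RC_field ^ 'i \<Rightarrow> 'k ^ 'i) \<Rightarrow> bool" where
  "orthogonal_projection Pr \<longleftrightarrow>
     (\<exists>U. vec.subspace U \<and> (\<forall>u. Pr u \<in> U \<and> (\<forall>v\<in>U. kip v (u - Pr u) = 0)))"

definition vec_stack :: "'a ^ 'i \<Rightarrow> 'a ^ 'j \<Rightarrow> 'a ^ ('i::finite + 'j::finite)" where
  "vec_stack u v = (\<chi> r. case r of Inl i \<Rightarrow> u $ i | Inr j \<Rightarrow> v $ j)"

definition mat_beside :: "'a ^ 'i ^ 'm \<Rightarrow> 'a ^ 'j ^ 'm \<Rightarrow> 'a ^ ('i::finite + 'j::finite) ^ 'm" where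
  "mat_beside A B = (\<chi> r. vec_stack (A $ r) (B $ r))"

text \<open>
  A Hilbert space over the scalars, carried by a real Banach space type whose norm is the
  one induced by the given inner product.
\<close>

locale hilbert_space_over = vector_space scale
  for scale :: "'k::RC_field \<Rightarrow> 'c::banach \<Rightarrow> 'c" +
  fixes ip :: "'c \<Rightarrow> 'c \<Rightarrow> 'k"
  assumes scale_of_real: "scale (of_real r) x = r *\<^sub>R x"
    and ip_add_right: "ip x (y + z) = ip x y + ip x z"
    and ip_scale_right: "ip x (scale a y) = a * ip x y"
    and ip_commute: "ip y x = kcnj (ip x y)"
    and ip_self: "ip x x = of_real ((norm x)\<^sup>2)"


section \<open>The space L2 and Sobolev spaces on the unit interval\<close>

definition square_integrable :: "real measure \<Rightarrow> (real \<Rightarrow> 'a::euclidean_space) \<Rightarrow> bool" where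
  "square_integrable M f \<longleftrightarrow>
     f \<in> borel_measurable M \<and> integrable M (\<lambda>s. (norm (f s))\<^sup>2)"

abbreviation I01 :: "real measure" where
  "I01 \<equiv> lebesgue_on {0<..<1}"

definition L2_rel :: "(real \<Rightarrow> 'a::euclidean_space) \<Rightarrow> (real \<Rightarrow> 'a) \<Rightarrow> bool" where
  "L2_rel f g \<longleftrightarrow> square_integrable I01 f \<and> square_integrable I01 g \<and> (AE s in I01. f s = g s)"

lemma square_integrable_zero: "square_integrable M (\<lambda>_. 0)"
  by (simp add: square_integrable_def)

lemma square_integrable_scaleR:
  "square_integrable M f \<Longrightarrow> square_integrable M (\<lambda>s. r *\<^sub>R f s)"
  by (auto simp: square_integrable_def power_mult_distrib)

lemma square_integrable_add:
  fixes f g :: "real \<Rightarrow> 'a::euclidean_space"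
  assumes "square_integrable M f" "square_integrable M g"
  shows "square_integrable M (\<lambda>s. f s + g s)"
proof -
  have [measurable]: "f \<in> borel_measurable M" "g \<in> borel_measurable M"
    and i: "integrable M (\<lambda>s. (norm (f s))\<^sup>2)" "integrable M (\<lambda>s. (norm (g s))\<^sup>2)"
    using assms by (auto simp: square_integrable_def)
  have le: "(norm (f s + g s))\<^sup>2 \<le> 2 * (norm (f s))\<^sup>2 + 2 * (norm (g s))\<^sup>2" for s
  proof -
    have "(norm (f s + g s))\<^sup>2 \<le> (norm (f s) + norm (g s))\<^sup>2"
      by (intro power_mono norm_triangle_ineq) simp
    also have "\<dots> \<le> 2 * (norm (f s))\<^sup>2 + 2 * (norm (g s))\<^sup>2"
      using sum_squares_ge_zero[of "norm (f s) - norm (g s)" 0]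
      by (simp add: power2_eq_square algebra_simps)
    finally show ?thesis .
  qed
  have "integrable M (\<lambda>s. (norm (f s + g s))\<^sup>2)"
    by (rule Bochner_Integration.integrable_bound
          [where f = "\<lambda>s. 2 * (norm (f s))\<^sup>2 + 2 * (norm (g s))\<^sup>2"])
      (use i le in auto)
  then show ?thesis by (simp add: square_integrable_def)
qed

lemma square_integrable_inner:
  fixes f g :: "real \<Rightarrow> 'a::euclidean_space"
  assumes "square_integrable M f" "square_integrable M g"
  shows "integrable M (\<lambda>s. inner (f s) (g s))"
proof -
  have [measurable]: "f \<in> borel_measurable M" "g \<in> borel_measurable M"
    and i: "integrable M (\<lambda>s. (norm (f s))\<^sup>2)" "integrable M (\<lambda>s. (norm (g s))\<^sup>2)"
    using assms by (auto simp: square_integrable_def)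
  have le: "\<bar>inner (f s) (g s)\<bar> \<le> (norm (f s))\<^sup>2 + (norm (g s))\<^sup>2" for s
  proof -
    have "2 * (norm (f s) * norm (g s)) \<le> (norm (f s))\<^sup>2 + (norm (g s))\<^sup>2"
      using sum_squares_ge_zero[of "norm (f s) - norm (g s)" 0]
      by (simp add: power2_eq_square algebra_simps)
    moreover have "0 \<le> norm (f s) * norm (g s)" by simp
    ultimately show ?thesis
      using Cauchy_Schwarz_ineq2[of "f s" "g s"] by linarith
  qed
  show ?thesis
    by (rule Bochner_Integration.integrable_bound
          [where f = "\<lambda>s. (norm (f s))\<^sup>2 + (norm (g s))\<^sup>2"])
      (use i le in auto)
qed

quotient_type (overloaded) 'a L2 = "real \<Rightarrow> 'a::euclidean_space" / partial: L2_rel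
proof (rule part_equivpI)
  show "\<exists>f::real \<Rightarrow> 'a. L2_rel f f"
    using square_integrable_zero by (auto simp: L2_rel_def)
  show "symp (L2_rel :: (real \<Rightarrow> 'a) \<Rightarrow> _)"
    by (auto intro!: sympI simp: L2_rel_def)
  show "transp (L2_rel :: (real \<Rightarrow> 'a) \<Rightarrow> _)"
    by (rule transpI) (auto simp: L2_rel_def elim: AE_mp)
qed

instantiation L2 :: (euclidean_space) real_inner
begin

lift_definition zero_L2 :: "'a L2" is "\<lambda>_. 0"
  by (simp add: L2_rel_def square_integrable_zero)

lift_definition plus_L2 :: "'a L2 \<Rightarrow> 'a L2 \<Rightarrow> 'a L2" is "\<lambda>f g s. f s + g s"
  by (auto simp: L2_rel_def square_integrable_add)

lift_definition scaleR_L2 :: "real \<Rightarrow> 'a L2 \<Rightarrow> 'a L2" is "\<lambda>r f s. r *\<^sub>R f s"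
  by (auto simp: L2_rel_def square_integrable_scaleR)

lift_definition inner_L2 :: "'a L2 \<Rightarrow> 'a L2 \<Rightarrow> real"
  is "\<lambda>f g. LINT s|I01. inner (f s) (g s)"
  by (intro integral_cong_AE)
    (auto simp: L2_rel_def square_integrable_def intro!: borel_measurable_inner)

definition uminus_L2 :: "'a L2 \<Rightarrow> 'a L2" where
  "uminus_L2 x = (-1) *\<^sub>R x"

definition minus_L2 :: "'a L2 \<Rightarrow> 'a L2 \<Rightarrow> 'a L2" where
  "minus_L2 x y = x + (- y)"

definition norm_L2 :: "'a L2 \<Rightarrow> real" where
  "norm_L2 x = sqrt (inner x x)"

definition sgn_L2 :: "'a L2 \<Rightarrow> 'a L2" where
  "sgn_L2 x = inverse (norm x) *\<^sub>R x"

definition dist_L2 :: "'a L2 \<Rightarrow> 'a L2 \<Rightarrow> real" where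
  "dist_L2 x y = norm (x - y)"

definition uniformity_L2 :: "('a L2 \<times> 'a L2) filter" where
  "uniformity_L2 = (INF e\<in>{0<..}. principal {(x, y). dist x y < e})"

definition open_L2 :: "'a L2 set \<Rightarrow> bool" where
  "open_L2 U \<longleftrightarrow> (\<forall>x\<in>U. \<forall>\<^sub>F (x', y) in uniformity. x' = x \<longrightarrow> y \<in> U)"

instance
proof
  fix x y z :: "'a L2" and a b :: real
  show "x + y + z = x + (y + z)"
    by transfer (auto simp: L2_rel_def square_integrable_add algebra_simps)
  show "x + y = y + x"
    by transfer (auto simp: L2_rel_def square_integrable_add algebra_simps)
  show "0 + x = x"
    by transfer (auto simp: L2_rel_def)
  show "- x + x = 0"
    unfolding uminus_L2_def
    by transfer (auto simp: L2_rel_def square_integrable_zero)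
  show "x - y = x + - y" by (simp add: minus_L2_def)
  show "a *\<^sub>R (x + y) = a *\<^sub>R x + a *\<^sub>R y"
    by transfer (auto simp: L2_rel_def algebra_simps intro!: square_integrable_add
        square_integrable_scaleR)
  show "(a + b) *\<^sub>R x = a *\<^sub>R x + b *\<^sub>R x"
    by transfer (auto simp: L2_rel_def algebra_simps intro!: square_integrable_add
        square_integrable_scaleR)
  show "a *\<^sub>R b *\<^sub>R x = (a * b) *\<^sub>R x"
    by transfer (auto simp: L2_rel_def intro!: square_integrable_scaleR)
  show "1 *\<^sub>R x = x"
    by transfer (auto simp: L2_rel_def)
  show "inner x y = inner y x"
    by transfer (simp add: inner_commute)
  show "inner (x + y) z = inner x z + inner y z"
    by transfer (simp add: L2_rel_def inner_add_left square_integrable_inner)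
  show "inner (a *\<^sub>R x) y = a * inner x y"
    by transfer simp
  show "0 \<le> inner x x"
    by transfer simp
  show "inner x x = 0 \<longleftrightarrow> x = 0"
    by transfer (subst integral_nonneg_eq_0_iff_AE,
      auto simp: L2_rel_def square_integrable_inner square_integrable_zero)
  show "norm x = sqrt (inner x x)" by (simp add: norm_L2_def)
  show "sgn x = inverse (norm x) *\<^sub>R x" by (simp add: sgn_L2_def)
  show "dist x y = norm (x - y)" by (simp add: dist_L2_def)
  show "uniformity = (INF e\<in>{0<..}. principal {(x::'a L2, y). dist x y < e})"
    by (simp add: uniformity_L2_def)
next
  fix U :: "'a L2 set"
  show "open U = (\<forall>x\<in>U. \<forall>\<^sub>F (x', y) in uniformity. x' = x \<longrightarrow> y \<in> U)"
    by (simp add: open_L2_def)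
qed

end

text \<open>Pointwise application of a matrix-valued function (meant for essentially bounded ones).\<close>

definition mul_L2 :: "(real \<Rightarrow> 'k::RC_field ^ 'd ^ 'd) \<Rightarrow> ('k ^ 'd) L2 \<Rightarrow> ('k ^ 'd) L2" where
  "mul_L2 F x = abs_L2 (\<lambda>s. F s *v rep_L2 x s)"

definition kip_L2 :: "('k::RC_field ^ 'd) L2 \<Rightarrow> ('k ^ 'd) L2 \<Rightarrow> 'k" where
  "kip_L2 x y = (LINT s|I01. kip (rep_L2 x s) (rep_L2 y s))"

text \<open>
  Weak derivatives are tested against real-valued continuously differentiable functions with
  compact support in the open interval; they are unique.
\<close>

definition weak_deriv :: "'a::euclidean_space L2 \<Rightarrow> 'a L2 \<Rightarrow> bool" where
  "weak_deriv g g' \<longleftrightarrow>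
     (\<forall>\<phi> \<phi>' :: real \<Rightarrow> real.
        (\<forall>s. (\<phi> has_real_derivative \<phi>' s) (at s)) \<and> continuous_on UNIV \<phi>' \<and>
        (\<exists>K. compact K \<and> K \<subseteq> {0<..<1} \<and> (\<forall>s. s \<notin> K \<longrightarrow> \<phi> s = 0)) \<longrightarrow>
        (LINT s|I01. \<phi>' s *\<^sub>R rep_L2 g s) = - (LINT s|I01. \<phi> s *\<^sub>R rep_L2 g' s))"

definition wderiv :: "'a::euclidean_space L2 \<Rightarrow> 'a L2" where
  "wderiv g = (THE g'. weak_deriv g g')"

primrec sobolev :: "nat \<Rightarrow> 'a::euclidean_space L2 set" where
  "sobolev 0 = UNIV"
| "sobolev (Suc m) = {g. \<exists>g'. weak_deriv g g' \<and> g' \<in> sobolev m}"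

text \<open>Point evaluation through the continuous representative on the closed interval.\<close>

definition trace_at :: "'a::euclidean_space L2 \<Rightarrow> real \<Rightarrow> 'a" where
  "trace_at g s = (THE v. \<exists>f. continuous_on {0..1} f \<and> (AE r in I01. f r = rep_L2 g r) \<and> v = f s)"


section \<open>Absolutely continuous functions\<close>

definition abs_continuous_on :: "real \<Rightarrow> real \<Rightarrow> (real \<Rightarrow> 'z::metric_space) \<Rightarrow> bool" where
  "abs_continuous_on a b f \<longleftrightarrow>
     (\<forall>\<epsilon>>0. \<exists>\<delta>>0. \<forall>(n::nat) l r.
        (\<forall>i<n. a \<le> l i \<and> l i \<le> r i \<and> r i \<le> b) \<and>
        (\<forall>i<n. \<forall>j<n. i \<noteq> j \<longrightarrow> {l i<..<r i} \<inter> {l j<..<r j} = {}) \<and>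
        (\<Sum>i<n. r i - l i) < \<delta> \<longrightarrow>
        (\<Sum>i<n. dist (f (l i)) (f (r i))) < \<epsilon>)"

definition abs_continuous_halfline :: "(real \<Rightarrow> 'z::metric_space) \<Rightarrow> bool" where
  "abs_continuous_halfline f \<longleftrightarrow> (\<forall>T>0. abs_continuous_on 0 T f)"

text \<open>
  \<open>W1_inf f f'\<close>: the class of \<open>f\<close> belongs to \<open>W\<^sup>1\<^sub>\<infinity>\<close> of the half line, with (weak) derivative
  \<open>f'\<close>.  As usual \<open>f\<close> is only determined up to null sets, hence the representative \<open>p\<close>.
\<close>

definition W1_inf :: "(real \<Rightarrow> 'z::real_normed_vector) \<Rightarrow> (real \<Rightarrow> 'z) \<Rightarrow> bool" where
  "W1_inf f f' \<longleftrightarrow>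
     (\<exists>p C. abs_continuous_halfline p \<and>
        (AE t in lebesgue_on {0..}. f t = p t \<and> (p has_vector_derivative f' t) (at t) \<and>
           norm (f t) \<le> C \<and> norm (f' t) \<le> C))"


section \<open>Multi-valued maps and semigroups\<close>

definition mdom :: "('z \<Rightarrow> 'z set) \<Rightarrow> 'z set" where
  "mdom A = {x. A x \<noteq> {}}"

definition dissipative :: "('z \<Rightarrow> 'z \<Rightarrow> 'k::RC_field) \<Rightarrow> ('z::ab_group_add \<Rightarrow> 'z set) \<Rightarrow> bool" where
  "dissipative ip A \<longleftrightarrow>
     (\<forall>x\<in>mdom A. \<forall>x'\<in>mdom A. \<forall>y\<in>A x. \<forall>y'\<in>A x'. kre (ip (y - y') (x - x')) \<le> 0)"

definition m_dissipative :: "('z \<Rightarrow> 'z \<Rightarrow> 'k::RC_field) \<Rightarrow> ('z::ab_group_add \<Rightarrow> 'z set) \<Rightarrow> bool" where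
  "m_dissipative ip A \<longleftrightarrow> dissipative ip A \<and> (\<Union>x\<in>mdom A. (\<lambda>y. x - y) ` A x) = UNIV"

text \<open>
  The contraction property refers to an explicitly given norm \<open>nrm\<close>.  Topological notions
  (closedness, continuity, absolute continuity, derivatives) are those of the type; below, \<open>nrm\<close>
  is equivalent to the norm of the type.
\<close>

definition contraction_semigroup ::
  "('z::real_normed_vector \<Rightarrow> real) \<Rightarrow> 'z set \<Rightarrow> (real \<Rightarrow> 'z \<Rightarrow> 'z) \<Rightarrow> bool" where
  "contraction_semigroup nrm Z S \<longleftrightarrow>
     closed Z \<and>
     (\<forall>t\<ge>0. \<forall>z\<in>Z. S t z \<in> Z) \<and>
     (\<forall>z\<in>Z. S 0 z = z) \<and>
     (\<forall>t\<ge>0. \<forall>s\<ge>0. \<forall>z\<in>Z. S (t + s) z = S t (S s z)) \<and>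
     (\<forall>t\<ge>0. \<forall>z\<in>Z. \<forall>z'\<in>Z. nrm (S t z - S t z') \<le> nrm (z - z')) \<and>
     (\<forall>z\<in>Z. continuous_on {0..} (\<lambda>t. S t z))"

definition inclusion_solution ::
  "('z::real_normed_vector \<Rightarrow> 'z set) \<Rightarrow> 'z \<Rightarrow> (real \<Rightarrow> 'z) \<Rightarrow> bool" where
  "inclusion_solution A z0 z \<longleftrightarrow>
     abs_continuous_halfline z \<and> z 0 = z0 \<and>
     (AE t in lebesgue_on {0..}. \<exists>z'. (z has_vector_derivative z') (at t) \<and> z' \<in> A (z t))"

definition generates ::
  "('z::real_normed_vector \<Rightarrow> real) \<Rightarrow> ('z \<Rightarrow> 'z set) \<Rightarrow> 'z set \<Rightarrow> (real \<Rightarrow> 'z \<Rightarrow> 'z) \<Rightarrow> bool" where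
  "generates nrm A Z S \<longleftrightarrow>
     Z = closure (mdom A) \<and> contraction_semigroup nrm Z S \<and>
     (\<forall>z0\<in>mdom A.
        inclusion_solution A z0 (\<lambda>t. S t z0) \<and>
        (\<exists>L. L-lipschitz_on {0..} (\<lambda>t. S t z0)) \<and>
        (\<forall>z. inclusion_solution A z0 z \<longrightarrow> (\<forall>t\<ge>0. z t = S t z0)))"


section \<open>Port-Hamiltonian systems\<close>

definition port_hamiltonian ::
  "nat \<Rightarrow> (nat \<Rightarrow> 'k::RC_field ^ 'd ^ 'd) \<Rightarrow> (real \<Rightarrow> 'k ^ 'd ^ 'd) \<Rightarrow> bool" where
  "port_hamiltonian N P H \<longleftrightarrow>
     N \<ge> 1 \<and>
     (\<forall>k\<in>{1..N}. kadj (P k) = (-1) ^ (k + 1) *\<^sub>R P k) \<and>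
     invertible (P N) \<and>
     (\<forall>v. kre (kip v (((1/2) *\<^sub>R (P 0 + kadj (P 0))) *v v)) \<le> 0) \<and>
     H \<in> borel_measurable I01 \<and>
     (\<exists>C. AE s in I01. norm (H s) \<le> C) \<and>
     (AE s in I01. kadj (H s) = H s) \<and>
     (\<exists>m>0. AE s in I01. \<forall>v. kre (kip v (H s *v v)) \<ge> m * (norm v)\<^sup>2)"

definition ip_H :: "(real \<Rightarrow> 'k::RC_field ^ 'd ^ 'd) \<Rightarrow> ('k ^ 'd) L2 \<Rightarrow> ('k ^ 'd) L2 \<Rightarrow> 'k" where
  "ip_H H x y = kip_L2 x (mul_L2 H y)"

definition norm_H :: "(real \<Rightarrow> 'k::RC_field ^ 'd ^ 'd) \<Rightarrow> ('k ^ 'd) L2 \<Rightarrow> real" where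
  "norm_H H x = sqrt (kre (ip_H H x x))"

definition pH_dom :: "nat \<Rightarrow> (real \<Rightarrow> 'k::RC_field ^ 'd ^ 'd) \<Rightarrow> ('k ^ 'd) L2 set" where
  "pH_dom N H = {x. mul_L2 H x \<in> sobolev N}"

definition pH_op ::
  "nat \<Rightarrow> (nat \<Rightarrow> 'k::RC_field ^ 'd ^ 'd) \<Rightarrow> (real \<Rightarrow> 'k ^ 'd ^ 'd) \<Rightarrow> ('k ^ 'd) L2 \<Rightarrow> ('k ^ 'd) L2" where
  "pH_op N P H x = (\<Sum>k\<le>N. mul_L2 (\<lambda>_. P k) ((wderiv ^^ k) (mul_L2 H x)))"

definition graph_norm ::
  "nat \<Rightarrow> (nat \<Rightarrow> 'k::RC_field ^ 'd ^ 'd) \<Rightarrow> (real \<Rightarrow> 'k ^ 'd ^ 'd) \<Rightarrow> ('k ^ 'd) L2 \<Rightarrow> real" where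
  "graph_norm N P H x = sqrt ((norm_H H x)\<^sup>2 + (norm_H H (pH_op N P H x))\<^sup>2)"

text \<open>
  A space of \<open>N\<close> blocks of size \<open>d\<close> is indexed by \<open>'n \<times> 'd\<close> with \<open>CARD('n) = N\<close>; the
  linear order on \<open>'n\<close> numbers the blocks, by \<open>block_pos\<close>, from \<open>0\<close> to \<open>N - 1\<close>.
\<close>

definition block_pos :: "'n::{finite,linorder} \<Rightarrow> nat" where
  "block_pos i = card {j. j < i}"

text \<open>With positions counted from 0, block \<open>(i, j)\<close> is \<open>(-1)\<^sup>i P\<^bsub>i+j+1\<^esub>\<close>.\<close>

definition pH_Q ::
  "(nat \<Rightarrow> 'k::RC_field ^ 'd ^ 'd) \<Rightarrow> 'k ^ ('n \<times> 'd) ^ ('n::{finite,linorder} \<times> 'd)" where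
  "pH_Q P = (\<chi> r c. let i = block_pos (fst r); j = block_pos (fst c) in
     if i + j + 1 \<le> CARD('n) then (-1) ^ i * P (i + j + 1) $ snd r $ snd c else 0)"

definition traces ::
  "(real \<Rightarrow> 'k::RC_field ^ 'd ^ 'd) \<Rightarrow> ('k ^ 'd) L2 \<Rightarrow> real \<Rightarrow> 'k ^ ('n::{finite,linorder} \<times> 'd)" where
  "traces H x s = (\<chi> r. trace_at ((wderiv ^^ block_pos (fst r)) (mul_L2 H x)) s $ snd r)"

definition boundary_variables ::
  "(nat \<Rightarrow> 'k::RC_field ^ 'd ^ 'd) \<Rightarrow> (real \<Rightarrow> 'k ^ 'd ^ 'd) \<Rightarrow> ('k ^ 'd) L2 \<Rightarrow>
     'k ^ (('n \<times> 'd) + ('n::{finite,linorder} \<times> 'd))" where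
  "boundary_variables P H x =
     (1 / sqrt 2) *\<^sub>R (vec_stack (mat_beside (pH_Q P) (- pH_Q P)) (mat_beside (mat 1) (mat 1))
        *v vec_stack (traces H x 1) (traces H x 0))"

text \<open>\<open>boundary_op P H W\<close> is the input map for \<open>W = W\<^sub>B\<close> and the output map for \<open>W = W\<^sub>C\<close>.\<close>

definition boundary_op ::
  "(nat \<Rightarrow> 'k::RC_field ^ 'd ^ 'd) \<Rightarrow> (real \<Rightarrow> 'k ^ 'd ^ 'd) \<Rightarrow>
     'k ^ (('n \<times> 'd) + ('n \<times> 'd)) ^ ('n::{finite,linorder} \<times> 'd) \<Rightarrow>
     ('k ^ 'd) L2 \<Rightarrow> 'k ^ ('n \<times> 'd)" where
  "boundary_op P H W x = W *v boundary_variables P H x"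

definition impedance_passive ::
  "nat \<Rightarrow> (nat \<Rightarrow> 'k::RC_field ^ 'd ^ 'd) \<Rightarrow> (real \<Rightarrow> 'k ^ 'd ^ 'd) \<Rightarrow>
     'k ^ (('n \<times> 'd) + ('n \<times> 'd)) ^ ('n::{finite,linorder} \<times> 'd) \<Rightarrow>
     'k ^ (('n \<times> 'd) + ('n \<times> 'd)) ^ ('n \<times> 'd) \<Rightarrow> bool" where
  "impedance_passive N P H WB WC \<longleftrightarrow>
     (\<forall>x\<in>pH_dom N H.
        kre (ip_H H (pH_op N P H x) x) \<le> kre (kip (boundary_op P H WB x) (boundary_op P H WC x)))"

text \<open>
  Solutions of \<open>x' = \<AA> x\<close> in \<open>W\<^sup>1\<^sub>\<infinity>(\<real>\<^sub>+; X) \<inter> L\<^sub>\<infinity>(\<real>\<^sub>+; D(\<AA>))\<close>.  The domain with its graph norm is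
  homeomorphic to the graph in the separable space \<open>X \<times> X\<close>, so that strong measurability of \<open>x\<close>
  as a map into the domain is Borel measurability of \<open>(x, \<AA> x)\<close>.
\<close>

definition bounded_pH_solution ::
  "nat \<Rightarrow> (nat \<Rightarrow> 'k::RC_field ^ 'd ^ 'd) \<Rightarrow> (real \<Rightarrow> 'k ^ 'd ^ 'd) \<Rightarrow>
     (real \<Rightarrow> ('k ^ 'd) L2) \<Rightarrow> bool" where
  "bounded_pH_solution N P H x \<longleftrightarrow>
     (\<exists>x'. W1_inf x x' \<and>
        (\<lambda>t. (x t, pH_op N P H (x t))) \<in> borel_measurable (lebesgue_on {0..}) \<and>
        (\<exists>C. AE t in lebesgue_on {0..}. x t \<in> pH_dom N H \<and> graph_norm N P H (x t) \<le> C) \<and>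
        (AE t in lebesgue_on {0..}. x' t = pH_op N P H (x t)))"


section \<open>Controllers and the interconnection\<close>

definition sum_ip ::
  "('c \<Rightarrow> 'c \<Rightarrow> 'k::RC_field) \<Rightarrow> 'c \<times> ('k ^ 'i) \<Rightarrow> 'c \<times> ('k ^ 'i) \<Rightarrow> 'k" where
  "sum_ip ip z w = ip (fst z) (fst w) + kip (snd z) (snd w)"

definition strong_solution ::
  "('c::real_normed_vector \<times> ('k::RC_field ^ 'i) \<Rightarrow> ('c \<times> ('k ^ 'i)) set) \<Rightarrow> real \<Rightarrow>
     (real \<Rightarrow> 'c) \<Rightarrow> (real \<Rightarrow> 'k ^ 'i) \<Rightarrow> (real \<Rightarrow> 'k ^ 'i) \<Rightarrow> bool" where
  "strong_solution Mc T xc uc yc \<longleftrightarrow>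
     abs_continuous_on 0 T xc \<and>
     square_integrable (lebesgue_on {0..T}) uc \<and> square_integrable (lebesgue_on {0..T}) yc \<and>
     (AE t in lebesgue_on {0..T}.
        \<exists>xc'. (xc has_vector_derivative xc') (at t) \<and> (xc', - yc t) \<in> Mc (xc t, uc t))"

definition mild_solution ::
  "('c::real_normed_vector \<times> ('k::RC_field ^ 'i) \<Rightarrow> ('c \<times> ('k ^ 'i)) set) \<Rightarrow> real \<Rightarrow>
     (real \<Rightarrow> 'c) \<Rightarrow> (real \<Rightarrow> 'k ^ 'i) \<Rightarrow> bool" where
  "mild_solution Mc T xc uc \<longleftrightarrow>
     square_integrable (lebesgue_on {0..T}) uc \<and>
     (\<exists>xs us ys. (\<forall>n::nat. strong_solution Mc T (xs n) (us n) (ys n)) \<and>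
        uniform_limit {0..T} xs xc sequentially \<and>
        (\<lambda>n. LINT t|lebesgue_on {0..T}. (norm (us n t - uc t))\<^sup>2) \<longlonglongrightarrow> 0)"

definition controller_assumption ::
  "('c::real_normed_vector \<Rightarrow> 'c \<Rightarrow> 'k::RC_field) \<Rightarrow>
     ('c \<times> ('k ^ 'i) \<Rightarrow> ('c \<times> ('k ^ 'i)) set) \<Rightarrow> ('k ^ 'i \<Rightarrow> 'k ^ 'i) \<Rightarrow> bool" where
  "controller_assumption ip Mc Pr \<longleftrightarrow>
     0 \<in> Mc 0 \<and> orthogonal_projection Pr \<and>
     (\<exists>\<rho>>0. \<forall>xc uc zc yc. (zc, yc) \<in> Mc (xc, uc) \<longrightarrow>
        kre (sum_ip ip (zc, yc) (xc, uc)) \<le> - \<rho> * ((norm xc)\<^sup>2 + (norm (Pr uc))\<^sup>2)) \<and>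
     (\<exists>c'>0. \<forall>xc uc zc yc. (zc, - yc) \<in> Mc (xc, uc) \<longrightarrow>
        (norm yc)\<^sup>2 \<le> c' * ((norm xc)\<^sup>2 + (norm (Pr uc))\<^sup>2)) \<and>
     (\<exists>t0>0. \<exists>\<delta>>0. \<exists>c0>0. \<forall>xc uc. mild_solution Mc t0 xc uc \<longrightarrow>
        (norm (xc t0))\<^sup>2 \<le> (1 - \<delta>) * (norm (xc 0))\<^sup>2
           + c0 * (LINT t|lebesgue_on {0..t0}. (norm (Pr (uc t)))\<^sup>2))"

definition interconnection ::
  "nat \<Rightarrow> (nat \<Rightarrow> 'k::RC_field ^ 'd ^ 'd) \<Rightarrow> (real \<Rightarrow> 'k ^ 'd ^ 'd) \<Rightarrow>
     'k ^ (('n \<times> 'd) + ('n \<times> 'd)) ^ ('n::{finite,linorder} \<times> 'd) \<Rightarrow>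
     'k ^ (('n \<times> 'd) + ('n \<times> 'd)) ^ ('n \<times> 'd) \<Rightarrow>
     ('c \<times> ('k ^ ('n \<times> 'd)) \<Rightarrow> ('c \<times> ('k ^ ('n \<times> 'd))) set) \<Rightarrow>
     ('k ^ 'd) L2 \<times> 'c \<Rightarrow> (('k ^ 'd) L2 \<times> 'c) set" where
  "interconnection N P H WB WC Mc z =
     {(pH_op N P H (fst z), zc) | zc.
        fst z \<in> pH_dom N H \<and>
        (zc, boundary_op P H WB (fst z)) \<in> Mc (snd z, boundary_op P H WC (fst z))}"

definition controller_space :: "('c::topological_space \<times> 'u \<Rightarrow> ('c \<times> 'u) set) \<Rightarrow> 'c set" where
  "controller_space Mc = closure (fst ` mdom Mc)"

definition norm_XXc ::
  "(real \<Rightarrow> 'k::RC_field ^ 'd ^ 'd) \<Rightarrow> ('k ^ 'd) L2 \<times> 'c::real_normed_vector \<Rightarrow> real" where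
  "norm_XXc H z = sqrt ((norm_H H (fst z))\<^sup>2 + (norm (snd z))\<^sup>2)"

end

theory Submission
  imports Defs
begin

text \<open>
  Let \<open>z(t) = (x(t), x\<^sub>c(t))\<close> be the orbit of a point of the domain of the interconnected map, let
  \<open>\<phi> = \<parallel>z\<parallel>\<^sup>2\<close> be its energy, and put \<open>h = \<parallel>x\<^sub>c\<parallel>\<^sup>2 + |\<Pi>\<CC>x|\<^sup>2\<close>.  Impedance passivity bounds the power
  that enters the port-Hamiltonian part by the power at its port, and the interconnection makes
  this port the port of the controller.  Strict dissipativity of the controller at its
  equilibrium \<open>0\<close> therefore gives \<open>\<phi>' \<le> - 2\<rho>h\<close> (\<open>interconnection_energy_bound\<close>).  So
  the energy decreases, but this controls only the part \<open>h\<close> of the state.  The missing part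
  \<open>\<parallel>x\<parallel>\<^sup>2\<close> is what the functional \<open>q\<close> is for: the controller output \<open>\<BB>x\<close> is bounded by \<open>h\<close> as
  well, whence \<open>\<parallel>x\<parallel>\<^sup>2 + q(x)' \<le> c(c' + 1)h\<close>.

  For small \<open>\<epsilon> > 0\<close> the sum \<open>V = \<phi> + \<epsilon>q(x)\<close> is then a strict Lyapunov function: it is comparable
  with \<open>\<phi>\<close> because \<open>q\<close> is bounded by the energy, and
  \<open>V' \<le> - \<epsilon>\<parallel>x\<parallel>\<^sup>2 - (2\<rho> - \<epsilon>c(c' + 1))h \<le> - \<epsilon>\<phi>\<close>.  Hence \<open>V\<close>, and with it \<open>\<phi>\<close>, decays exponentially
  (\<open>lyapunov_exponential_decay\<close>), at a rate that depends on the constants only.  As the semigroup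
  is contractive, the estimate passes from the domain to its closure
  (\<open>contraction_semigroup_extend_bound\<close>).

  All these inequalities hold at almost every time only.  What turns them into estimates at every
  time is that an absolutely continuous function with nonpositive derivative almost everywhere
  does not increase (\<open>abs_continuous_on_deriv_nonpos_imp_le\<close>).  The remaining work is to show
  that the energy is a bounded coercive symmetric form, so that \<open>\<phi>\<close> can be differentiated, and
  that \<open>x\<close> has the regularity under which the inequality for \<open>q\<close> is available
  (\<open>bounded_pH_solutionI\<close>).
\<close>

section \<open>Absolutely continuous functions\<close>

lemma abs_continuous_onE:
  assumes "abs_continuous_on a b f" "e > 0"
  obtains d where "d > 0" "\<And>(n::nat) l r.
        (\<forall>i<n. a \<le> l i \<and> l i \<le> r i \<and> r i \<le> b) \<Longrightarrow>
        (\<forall>i<n. \<forall>j<n. i \<noteq> j \<longrightarrow> {l i<..<r i} \<inter> {l j<..<r j} = {}) \<Longrightarrow>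
        (\<Sum>i<n. r i - l i) < d \<Longrightarrow> (\<Sum>i<n. dist (f (l i)) (f (r i))) < e"
proof -
  from assms(1)[unfolded abs_continuous_on_def, rule_format, OF assms(2)]
  show thesis by (elim exE conjE) (rule that, assumption, blast)
qed

text \<open>
  Sums, bilinear products, components and Lipschitz functions all inherit absolute continuity
  through this one comparison with two absolutely continuous functions.
\<close>

lemma abs_continuous_on_dominated:
  assumes f: "abs_continuous_on a b f" and g: "abs_continuous_on a b g"
    and dom: "\<And>s t. s \<in> {a..b} \<Longrightarrow> t \<in> {a..b} \<Longrightarrow>
      dist (h s) (h t) \<le> L * (dist (f s) (f t) + dist (g s) (g t))"
  shows "abs_continuous_on a b h"
  unfolding abs_continuous_on_def
proof (intro allI impI)
  fix e :: real assume e: "e > 0"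
  define K where "K = max 1 L"
  have K: "K > 0" "L \<le> K" by (auto simp: K_def)
  define e' where "e' = e / (2 * K)"
  have e': "e' > 0" using e K by (simp add: e'_def)
  obtain d1 where d1: "d1 > 0" "\<And>(n::nat) l r.
        (\<forall>i<n. a \<le> l i \<and> l i \<le> r i \<and> r i \<le> b) \<Longrightarrow>
        (\<forall>i<n. \<forall>j<n. i \<noteq> j \<longrightarrow> {l i<..<r i} \<inter> {l j<..<r j} = {}) \<Longrightarrow>
        (\<Sum>i<n. r i - l i) < d1 \<Longrightarrow> (\<Sum>i<n. dist (f (l i)) (f (r i))) < e'"
    using abs_continuous_onE[OF f e'] by blast
  obtain d2 where d2: "d2 > 0" "\<And>(n::nat) l r.
        (\<forall>i<n. a \<le> l i \<and> l i \<le> r i \<and> r i \<le> b) \<Longrightarrow>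
        (\<forall>i<n. \<forall>j<n. i \<noteq> j \<longrightarrow> {l i<..<r i} \<inter> {l j<..<r j} = {}) \<Longrightarrow>
        (\<Sum>i<n. r i - l i) < d2 \<Longrightarrow> (\<Sum>i<n. dist (g (l i)) (g (r i))) < e'"
    using abs_continuous_onE[OF g e'] by blast
  show "\<exists>d>0. \<forall>(n::nat) l r.
        (\<forall>i<n. a \<le> l i \<and> l i \<le> r i \<and> r i \<le> b) \<and>
        (\<forall>i<n. \<forall>j<n. i \<noteq> j \<longrightarrow> {l i<..<r i} \<inter> {l j<..<r j} = {}) \<and>
        (\<Sum>i<n. r i - l i) < d \<longrightarrow> (\<Sum>i<n. dist (h (l i)) (h (r i))) < e"
  proof (intro exI[of _ "min d1 d2"] conjI allI impI)
    show "min d1 d2 > 0" using d1 d2 by simp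
  next
    fix n :: nat and l r :: "nat \<Rightarrow> real"
    assume *: "(\<forall>i<n. a \<le> l i \<and> l i \<le> r i \<and> r i \<le> b) \<and>
        (\<forall>i<n. \<forall>j<n. i \<noteq> j \<longrightarrow> {l i<..<r i} \<inter> {l j<..<r j} = {}) \<and>
        (\<Sum>i<n. r i - l i) < min d1 d2"
    have "(\<Sum>i<n. dist (h (l i)) (h (r i)))
      \<le> (\<Sum>i<n. K * (dist (f (l i)) (f (r i)) + dist (g (l i)) (g (r i))))"
    proof (rule sum_mono)
      fix i assume "i \<in> {..<n}"
      then have "l i \<in> {a..b}" "r i \<in> {a..b}" using * by force+
      from dom[OF this] show "dist (h (l i)) (h (r i))
          \<le> K * (dist (f (l i)) (f (r i)) + dist (g (l i)) (g (r i)))"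
        by (rule order_trans) (intro mult_right_mono K(2), simp)
    qed
    also have "\<dots> = K * ((\<Sum>i<n. dist (f (l i)) (f (r i))) + (\<Sum>i<n. dist (g (l i)) (g (r i))))"
      by (simp add: sum_distrib_left[symmetric] sum.distrib)
    also have "\<dots> < K * (e' + e')"
      using d1(2)[of n l r] d2(2)[of n l r] * K by (intro mult_strict_left_mono add_strict_mono) auto
    also have "\<dots> = e" using K by (simp add: e'_def)
    finally show "(\<Sum>i<n. dist (h (l i)) (h (r i))) < e" .
  qed
qed

lemma abs_continuous_on_ident: "abs_continuous_on a b (\<lambda>t::real. t)"
  unfolding abs_continuous_on_def
proof (intro allI impI)
  fix e :: real assume "e > 0"
  show "\<exists>d>0. \<forall>(n::nat) l r.
        (\<forall>i<n. a \<le> l i \<and> l i \<le> r i \<and> r i \<le> b) \<and>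
        (\<forall>i<n. \<forall>j<n. i \<noteq> j \<longrightarrow> {l i<..<r i} \<inter> {l j<..<r j} = {}) \<and>
        (\<Sum>i<n. r i - l i) < d \<longrightarrow> (\<Sum>i<n. dist (l i) (r i)) < e"
  proof (intro exI[of _ e] conjI allI impI)
    fix n :: nat and l r :: "nat \<Rightarrow> real"
    assume *: "(\<forall>i<n. a \<le> l i \<and> l i \<le> r i \<and> r i \<le> b) \<and>
        (\<forall>i<n. \<forall>j<n. i \<noteq> j \<longrightarrow> {l i<..<r i} \<inter> {l j<..<r j} = {}) \<and>
        (\<Sum>i<n. r i - l i) < e"
    then have "(\<Sum>i<n. dist (l i) (r i)) = (\<Sum>i<n. r i - l i)"
      by (intro sum.cong) (auto simp: dist_real_def)
    with * show "(\<Sum>i<n. dist (l i) (r i)) < e" by simp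
  qed fact
qed

lemma abs_continuous_on_imp_continuous_on:
  assumes f: "abs_continuous_on a b f"
  shows "continuous_on {a..b} f"
  unfolding continuous_on_iff
proof (intro ballI allI impI)
  fix x e :: real assume x: "x \<in> {a..b}" and e: "e > 0"
  obtain d where d: "d > 0" "\<And>(n::nat) l r.
        (\<forall>i<n. a \<le> l i \<and> l i \<le> r i \<and> r i \<le> b) \<Longrightarrow>
        (\<forall>i<n. \<forall>j<n. i \<noteq> j \<longrightarrow> {l i<..<r i} \<inter> {l j<..<r j} = {}) \<Longrightarrow>
        (\<Sum>i<n. r i - l i) < d \<Longrightarrow> (\<Sum>i<n. dist (f (l i)) (f (r i))) < e"
    using abs_continuous_onE[OF f e] by blast
  show "\<exists>d>0. \<forall>x'\<in>{a..b}. dist x' x < d \<longrightarrow> dist (f x') (f x) < e"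
  proof (intro exI[of _ d] conjI ballI impI)
    fix y assume y: "y \<in> {a..b}" "dist y x < d"
    have "(\<Sum>i<1::nat. dist (f (min x y)) (f (max x y))) < e"
      using x y by (intro d(2)) (auto simp: dist_real_def)
    then show "dist (f y) (f x) < e" by (simp add: dist_commute min_def max_def split: if_splits)
  qed fact
qed

lemma lipschitz_on_imp_abs_continuous_on:
  assumes "L-lipschitz_on {a..b} f"
  shows "abs_continuous_on a b f"
proof (rule abs_continuous_on_dominated[OF abs_continuous_on_ident abs_continuous_on_ident])
  fix s t assume "s \<in> {a..b}" "t \<in> {a..b}"
  then have "dist (f s) (f t) \<le> L * dist s t" "0 \<le> L"
    using assms by (auto simp: lipschitz_on_def)
  moreover have "L * dist s t \<le> L * (dist s t + dist s t)"
    using \<open>0 \<le> L\<close> by (intro mult_left_mono) auto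
  ultimately show "dist (f s) (f t) \<le> L * (dist s t + dist s t)" by linarith
qed

lemma abs_continuous_on_add:
  fixes f g :: "real \<Rightarrow> 'a::real_normed_vector"
  assumes "abs_continuous_on a b f" "abs_continuous_on a b g"
  shows "abs_continuous_on a b (\<lambda>t. f t + g t)"
  by (rule abs_continuous_on_dominated[OF assms, of _ 1]) (simp add: dist_triangle_add)

text \<open>
  On a compact interval both factors are bounded, so the product rule for increments dominates
  the increments of the product by those of the factors.
\<close>

lemma (in bounded_bilinear) abs_continuous_on:
  assumes f: "abs_continuous_on s t f" and g: "abs_continuous_on s t g"
  shows "abs_continuous_on s t (\<lambda>r. prod (f r) (g r))"
proof -
  obtain K where K: "K > 0" "\<And>a b. norm (prod a b) \<le> norm a * norm b * K"
    using pos_bounded by blast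
  have "compact (f ` {s..t})" "compact (g ` {s..t})"
    using f g by (auto intro!: compact_continuous_image abs_continuous_on_imp_continuous_on)
  then have "bounded (f ` {s..t})" "bounded (g ` {s..t})" by (simp_all add: compact_imp_bounded)
  then obtain A B where A: "\<And>r. r \<in> {s..t} \<Longrightarrow> norm (f r) \<le> A"
    and B: "\<And>r. r \<in> {s..t} \<Longrightarrow> norm (g r) \<le> B"
    unfolding bounded_iff by (metis imageI)
  define C where "C = max 0 (max A B)"
  have C: "0 \<le> C" "\<And>r. r \<in> {s..t} \<Longrightarrow> norm (f r) \<le> C" "\<And>r. r \<in> {s..t} \<Longrightarrow> norm (g r) \<le> C"
    unfolding C_def using A B by (auto simp: le_max_iff_disj)
  show ?thesis
  proof (rule abs_continuous_on_dominated[OF f g])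
    fix p r assume pr: "p \<in> {s..t}" "r \<in> {s..t}"
    have "prod (f p) (g p) - prod (f r) (g r)
        = prod (f p - f r) (g p) + prod (f r) (g p - g r)"
      by (simp add: diff_left diff_right)
    then have "dist (prod (f p) (g p)) (prod (f r) (g r))
        \<le> norm (prod (f p - f r) (g p)) + norm (prod (f r) (g p - g r))"
      by (simp add: dist_norm norm_triangle_ineq)
    also have "\<dots> \<le> norm (f p - f r) * norm (g p) * K + norm (f r) * norm (g p - g r) * K"
      by (intro add_mono K)
    also have "\<dots> \<le> norm (f p - f r) * C * K + C * norm (g p - g r) * K"
      using K C pr by (intro add_mono mult_right_mono mult_left_mono) auto
    finally show "dist (prod (f p) (g p)) (prod (f r) (g r))
        \<le> (C * K) * (dist (f p) (f r) + dist (g p) (g r))"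
      by (simp add: dist_norm algebra_simps)
  qed
qed

text \<open>
  The definition speaks of intervals numbered by natural numbers; the cells of a tagged division
  come as an unordered finite set.
\<close>

lemma abs_continuous_on_sum_dist_less:
  fixes f :: "real \<Rightarrow> 'z::metric_space"
  assumes f: "abs_continuous_on a b f" and e: "e > 0"
  shows "\<exists>d>0. \<forall>(I :: 'i set) l r. finite I \<longrightarrow> (\<forall>i\<in>I. a \<le> l i \<and> l i \<le> r i \<and> r i \<le> b) \<longrightarrow>
       (\<forall>i\<in>I. \<forall>j\<in>I. i \<noteq> j \<longrightarrow> {l i<..<r i} \<inter> {l j<..<r j} = {}) \<longrightarrow>
       (\<Sum>i\<in>I. r i - l i) < d \<longrightarrow> (\<Sum>i\<in>I. dist (f (l i)) (f (r i))) < e"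
proof -
  obtain d where d: "d > 0" "\<And>(n::nat) l r.
        (\<forall>i<n. a \<le> l i \<and> l i \<le> r i \<and> r i \<le> b) \<Longrightarrow>
        (\<forall>i<n. \<forall>j<n. i \<noteq> j \<longrightarrow> {l i<..<r i} \<inter> {l j<..<r j} = {}) \<Longrightarrow>
        (\<Sum>i<n. r i - l i) < d \<Longrightarrow> (\<Sum>i<n. dist (f (l i)) (f (r i))) < e"
    using abs_continuous_onE[OF f e] by blast
  show ?thesis
  proof (intro exI[of _ d] conjI[OF d(1)] allI impI)
    fix I :: "'i set" and l r
    assume I: "finite I" "\<forall>i\<in>I. a \<le> l i \<and> l i \<le> r i \<and> r i \<le> b"
       "\<forall>i\<in>I. \<forall>j\<in>I. i \<noteq> j \<longrightarrow> {l i<..<r i} \<inter> {l j<..<r j} = {}"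
       "(\<Sum>i\<in>I. r i - l i) < d"
    obtain h where h: "bij_betw h {..<card I} I"
      using ex_bij_betw_nat_finite[OF I(1)] by (auto simp: atLeast0LessThan)
    have hI: "h k \<in> I" if "k < card I" for k using h that by (auto simp: bij_betw_def)
    have "(\<Sum>k<card I. dist (f (l (h k))) (f (r (h k)))) < e"
    proof (rule d(2))
      show "\<forall>k<card I. a \<le> l (h k) \<and> l (h k) \<le> r (h k) \<and> r (h k) \<le> b" using I(2) hI by blast
      show "\<forall>k<card I. \<forall>j<card I. k \<noteq> j \<longrightarrow> {l (h k)<..<r (h k)} \<inter> {l (h j)<..<r (h j)} = {}"
      proof (intro allI impI)
        fix k j assume kj: "k < card I" "j < card I" "k \<noteq> j"
        then have "h k \<noteq> h j" using h by (auto simp: bij_betw_def inj_on_def)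
        with kj hI I(3) show "{l (h k)<..<r (h k)} \<inter> {l (h j)<..<r (h j)} = {}" by blast
      qed
      show "(\<Sum>k<card I. r (h k) - l (h k)) < d"
        using I(4) sum.reindex_bij_betw[OF h, of "\<lambda>i. r i - l i"] by simp
    qed
    then show "(\<Sum>i\<in>I. dist (f (l i)) (f (r i))) < e"
      using sum.reindex_bij_betw[OF h, of "\<lambda>i. dist (f (l i)) (f (r i))"] by simp
  qed
qed

text \<open>
  The straddle estimate of gauge integration: around a point with nonpositive derivative, small
  intervals containing the point carry almost no increase.
\<close>

lemma has_real_derivative_nonpos_straddle:
  assumes f: "(f has_real_derivative D) (at t)" and D: "D \<le> 0" and e: "e > 0"
  obtains \<delta> where "\<delta> > 0"
    "\<And>u v. u \<le> t \<Longrightarrow> t \<le> v \<Longrightarrow> {u..v} \<subseteq> ball t \<delta> \<Longrightarrow> f v - f u \<le> e * (v - u)"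
proof -
  obtain \<delta> where \<delta>: "\<delta> > 0"
    "\<And>y. norm (y - t) < \<delta> \<Longrightarrow> norm (f y - f t - D * (y - t)) \<le> e * norm (y - t)"
    using f e unfolding has_field_derivative_def has_derivative_at_alt by metis
  show thesis
  proof (rule that[OF \<delta>(1)])
    fix u v assume uv: "u \<le> t" "t \<le> v" "{u..v} \<subseteq> ball t \<delta>"
    then have "u \<in> ball t \<delta>" "v \<in> ball t \<delta>" using subsetD[OF uv(3)] by simp_all
    then have "\<bar>f v - f t - D * (v - t)\<bar> \<le> e * (v - t)" "\<bar>f u - f t - D * (u - t)\<bar> \<le> e * (t - u)"
      using \<delta>(2)[of v] \<delta>(2)[of u] uv by (auto simp: dist_real_def)
    then have "f v - f u \<le> D * (v - u) + e * (v - u)"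
      by (auto simp: algebra_simps abs_le_iff)
    moreover have "D * (v - u) \<le> 0" using D uv by (simp add: mult_nonpos_nonneg)
    ultimately show "f v - f u \<le> e * (v - u)" by linarith
  qed
qed

text \<open>
  Cousin's lemma reduces this to a finite sum.  The gauge is chosen such that a cell tagged
  outside the null set \<open>E\<close> satisfies the straddle estimate, while the cells tagged in \<open>E\<close> lie in
  an open set of small measure, where absolute continuity makes the total increase small.
\<close>

theorem abs_continuous_on_deriv_nonpos_imp_le:
  fixes f :: "real \<Rightarrow> real"
  assumes f: "abs_continuous_on a b f" and ab: "a \<le> b" and E: "negligible E"
    and deriv: "\<And>t. t \<in> {a..b} - E \<Longrightarrow> \<exists>D\<le>0. (f has_real_derivative D) (at t)"
  shows "f b \<le> f a"
proof -
  have main: "f b - f a \<le> e * (b - a) + e" if e: "e > 0" for e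
  proof -
    obtain d where d: "d > 0"
      "\<forall>(I :: (real \<times> real set) set) l r. finite I \<longrightarrow>
         (\<forall>i\<in>I. a \<le> l i \<and> l i \<le> r i \<and> r i \<le> b) \<longrightarrow>
         (\<forall>i\<in>I. \<forall>j\<in>I. i \<noteq> j \<longrightarrow> {l i<..<r i} \<inter> {l j<..<r j} = {}) \<longrightarrow>
         (\<Sum>i\<in>I. r i - l i) < d \<longrightarrow> (\<Sum>i\<in>I. dist (f (l i)) (f (r i))) < e"
      using abs_continuous_on_sum_dist_less[OF f e, where 'i = "real \<times> real set"]
      by (elim exE conjE)
    obtain U where U: "open U" "E \<subseteq> U" "U \<in> lmeasurable" "measure lebesgue U < d"
    proof -
      have E': "E \<in> null_sets lebesgue" using E by (simp add: negligible_iff_null_sets)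
      obtain T where T: "open T" "E \<subseteq> T" "T - E \<in> lmeasurable" "emeasure lebesgue (T - E) < ennreal d"
        by (rule sets_lebesgue_outer_open[OF null_setsD2[OF E'] d(1)])
      have eq: "T = (T - E) \<union> E" using T(2) by blast
      have "T \<in> lmeasurable"
        by (subst eq) (intro fmeasurable.Un T(3) fmeasurableI_null_sets E')
      moreover have "measure lebesgue T = measure lebesgue (T - E)"
        by (subst eq) (intro measure_Un_null_set E' fmeasurableD T(3))
      moreover have "measure lebesgue (T - E) < d"
        using T(3,4) d(1) by (simp add: emeasure_eq_measure2 ennreal_less_iff)
      ultimately show thesis using T by (intro that[of T]) auto
    qed
    have "\<exists>\<delta>>0. \<forall>u v. u \<le> t \<and> t \<le> v \<and> {u..v} \<subseteq> ball t \<delta> \<longrightarrow> f v - f u \<le> e * (v - u)"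
      if t: "t \<in> {a..b} - E" for t
    proof -
      obtain D where "D \<le> 0" "(f has_real_derivative D) (at t)" using deriv[OF t] by blast
      from has_real_derivative_nonpos_straddle[OF this(2,1) e] show ?thesis by metis
    qed
    then obtain \<delta> where \<delta>: "\<And>t. t \<in> {a..b} - E \<Longrightarrow> \<delta> t > 0"
      "\<And>t u v. t \<in> {a..b} - E \<Longrightarrow> u \<le> t \<Longrightarrow> t \<le> v \<Longrightarrow> {u..v} \<subseteq> ball t (\<delta> t) \<Longrightarrow>
         f v - f u \<le> e * (v - u)"
      by metis
    define \<gamma> where "\<gamma> t = (if t \<in> E then U else if t \<in> {a..b} then ball t (\<delta> t) else UNIV)" for t
    have "gauge \<gamma>" unfolding gauge_def \<gamma>_def using U \<delta>(1) by auto
    then obtain p where p: "p tagged_division_of {a..b}" "\<gamma> fine p"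
      by (rule fine_division_exists_real)
    have fin: "finite p" using p(1) by (rule tagged_division_ofD)
    have cell: "fst i \<in> {a..b} \<and> snd i = {Inf (snd i)..Sup (snd i)} \<and> Inf (snd i) \<le> fst i \<and>
        fst i \<le> Sup (snd i) \<and> a \<le> Inf (snd i) \<and> Sup (snd i) \<le> b \<and> snd i \<subseteq> \<gamma> (fst i)"
      if "i \<in> p" for i
    proof -
      obtain t K where i: "i = (t, K)" by force
      note tK = tagged_division_ofD(2-4)[OF p(1) that[unfolded i]]
      obtain u v where K: "K = {u..v}" using tK(3) by (auto simp: cbox_interval)
      then have "u \<le> v" using tK(1) by auto
      then have *: "Inf K = u" "Sup K = v" using K by auto
      have "K \<subseteq> \<gamma> t" using p(2) that i by (auto simp: fine_def)
      then show ?thesis using tK(1,2) K * \<open>u \<le> v\<close> by (auto simp: i)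
    qed
    \<comment> \<open>cells tagged at differentiability points, and cells tagged in the null set\<close>
    define p1 where "p1 = {i\<in>p. fst i \<notin> E}"
    define p2 where "p2 = {i\<in>p. fst i \<in> E}"
    have split: "sum F p = sum F p1 + sum F p2" for F :: "real \<times> real set \<Rightarrow> real"
    proof -
      have "p = p1 \<union> p2" "p1 \<inter> p2 = {}" by (auto simp: p1_def p2_def)
      then show ?thesis using fin by (metis finite_Un sum.union_disjoint)
    qed
    have len: "(\<Sum>i\<in>p. Sup (snd i) - Inf (snd i)) = b - a"
      using additive_tagged_division_1[OF ab p(1), of "\<lambda>x. x"] by (simp add: case_prod_unfold)
    have "(\<Sum>i\<in>p1. f (Sup (snd i)) - f (Inf (snd i))) \<le> (\<Sum>i\<in>p1. e * (Sup (snd i) - Inf (snd i)))"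
    proof (rule sum_mono)
      fix i assume i: "i \<in> p1"
      then have ip: "i \<in> p" "fst i \<in> {a..b} - E" using cell[of i] by (auto simp: p1_def)
      show "f (Sup (snd i)) - f (Inf (snd i)) \<le> e * (Sup (snd i) - Inf (snd i))"
        using cell[OF ip(1)] ip(2) by (intro \<delta>(2)[OF ip(2)]) (auto simp: \<gamma>_def)
    qed
    also have "\<dots> \<le> e * (\<Sum>i\<in>p. Sup (snd i) - Inf (snd i))"
    proof -
      have "(\<Sum>i\<in>p1. Sup (snd i) - Inf (snd i)) \<le> (\<Sum>i\<in>p. Sup (snd i) - Inf (snd i))"
        using cell fin by (intro sum_mono2) (force simp: p1_def)+
      then show ?thesis using e by (simp add: sum_distrib_left[symmetric])
    qed
    finally have good: "(\<Sum>i\<in>p1. f (Sup (snd i)) - f (Inf (snd i))) \<le> e * (b - a)"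
      by (simp add: len)
    have disj: "{Inf (snd i)<..<Sup (snd i)} \<inter> {Inf (snd j)<..<Sup (snd j)} = {}"
      if "i \<in> p2" "j \<in> p2" "i \<noteq> j" for i j
    proof -
      have ij: "i \<in> p" "j \<in> p" using that by (auto simp: p2_def)
      then have "interior (snd i) \<inter> interior (snd j) = {}"
        using tagged_division_ofD(5)[OF p(1), of "fst i" "snd i" "fst j" "snd j"] that(3)
        by (auto simp: prod_eq_iff)
      moreover have "interior (snd k) = {Inf (snd k)<..<Sup (snd k)}" if "k \<in> p" for k
        by (metis cell[OF that] interior_atLeastAtMost_real)
      ultimately show ?thesis using ij by simp
    qed
    have "(\<Sum>i\<in>p2. Sup (snd i) - Inf (snd i))
        = (\<Sum>i\<in>p2. measure lebesgue {Inf (snd i)<..<Sup (snd i)})"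
      using cell by (intro sum.cong) (force simp: p2_def)+
    also have "\<dots> = measure lebesgue (\<Union>i\<in>p2. {Inf (snd i)<..<Sup (snd i)})"
    proof (rule measure_finite_Union[symmetric])
      show "disjoint_family_on (\<lambda>i. {Inf (snd i)<..<Sup (snd i)}) p2"
        using disj unfolding disjoint_family_on_def by blast
      show "emeasure lebesgue {Inf (snd i)<..<Sup (snd i)} \<noteq> \<infinity>" if "i \<in> p2" for i
        using cell[of i] that by (simp add: p2_def)
    qed (use fin in \<open>auto simp: p2_def\<close>)
    also have "\<dots> \<le> measure lebesgue U"
    proof (rule measure_mono_fmeasurable[OF _ _ U(3)])
      show "(\<Union>i\<in>p2. {Inf (snd i)<..<Sup (snd i)}) \<subseteq> U"
      proof (intro UN_least)
        fix i assume "i \<in> p2"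
        then have i: "i \<in> p" "fst i \<in> E" by (auto simp: p2_def)
        have "{Inf (snd i)<..<Sup (snd i)} \<subseteq> {Inf (snd i)..Sup (snd i)}" by auto
        also have "\<dots> \<subseteq> U" using cell[OF i(1)] i(2) by (simp add: \<gamma>_def)
        finally show "{Inf (snd i)<..<Sup (snd i)} \<subseteq> U" .
      qed
      show "(\<Union>i\<in>p2. {Inf (snd i)<..<Sup (snd i)}) \<in> sets lebesgue"
        by (intro sets_completionI_sets) (simp, rule borel_open, auto)
    qed
    also have "\<dots> < d" by (rule U)
    finally have small: "(\<Sum>i\<in>p2. Sup (snd i) - Inf (snd i)) < d" .
    have "(\<Sum>i\<in>p2. f (Sup (snd i)) - f (Inf (snd i)))
        \<le> (\<Sum>i\<in>p2. dist (f (Inf (snd i))) (f (Sup (snd i))))"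
      by (intro sum_mono) (simp add: dist_real_def)
    also have "\<dots> < e"
    proof (rule d(2)[rule_format])
      show "finite p2" using fin by (simp add: p2_def)
      show "a \<le> Inf (snd i) \<and> Inf (snd i) \<le> Sup (snd i) \<and> Sup (snd i) \<le> b" if "i \<in> p2" for i
        using cell[of i] that by (auto simp: p2_def)
    qed (use disj small in auto)
    finally have bad: "(\<Sum>i\<in>p2. f (Sup (snd i)) - f (Inf (snd i))) < e" .
    have "f b - f a = (\<Sum>i\<in>p. f (Sup (snd i)) - f (Inf (snd i)))"
      using additive_tagged_division_1[OF ab p(1), of f] by (simp add: case_prod_unfold)
    with split[of "\<lambda>i. f (Sup (snd i)) - f (Inf (snd i))"] good bad show ?thesis by linarith
  qed
  show ?thesis
  proof (rule field_le_epsilon)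
    fix e :: real assume e: "e > 0"
    define e' where "e' = e / (b - a + 1)"
    have "e' > 0" using e ab by (simp add: e'_def)
    have "e' * (b - a) + e' = e' * (b - a + 1)" by (simp add: algebra_simps)
    also have "\<dots> = e" using ab by (simp add: e'_def)
    finally show "f b \<le> f a + e" using main[OF \<open>e' > 0\<close>] by linarith
  qed
qed

lemma AE_halfline_imp_negligible:
  assumes "AE t in lebesgue_on {0::real..}. P t"
  shows "\<exists>E. negligible E \<and> (\<forall>t\<ge>0. t \<notin> E \<longrightarrow> P t)"
proof -
  have "AE t in lebesgue. t \<in> {0..} \<longrightarrow> P t"
    using assms by (subst (asm) AE_restrict_space_iff) auto
  then obtain E where "E \<in> null_sets lebesgue" "{t\<in>space lebesgue. \<not> (t \<in> {0..} \<longrightarrow> P t)} \<subseteq> E"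
    unfolding eventually_ae_filter by blast
  then show ?thesis by (intro exI[of _ E]) (auto simp: negligible_iff_null_sets)
qed

lemma AE_halflineI:
  assumes "negligible E" "\<And>t. t > 0 \<Longrightarrow> t \<notin> E \<Longrightarrow> P t"
  shows "AE t in lebesgue_on {0::real..}. P t"
proof -
  have "insert 0 E \<in> null_sets lebesgue"
    using assms(1) by (simp flip: negligible_iff_null_sets)
  then have "AE t in lebesgue. t \<in> {0..} \<longrightarrow> P t"
    by (rule AE_I') (use assms(2) in force)
  then show ?thesis by (subst AE_restrict_space_iff) auto
qed

section \<open>The real part of the energy inner product\<close>

text \<open>
  Real and complex scalars can be treated together: over the reals \<open>u = 0\<close> serves as the
  imaginary unit, and identities for the conjugation become identities between coordinates.
\<close>

lemma RC_field_coordinates: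
  obtains u :: "'k::RC_field" where "inner u 1 = 0" "u * u = - (inner u u *\<^sub>R 1)"
    "\<And>z. \<exists>r x. z = r *\<^sub>R 1 + x *\<^sub>R u"
  using RC_field_cases[where 'k = 'k]
proof
  assume real: "\<forall>z::'k. z = of_real (kre z)"
  show thesis
  proof (rule that[of 0])
    show "\<exists>r x. z = r *\<^sub>R 1 + x *\<^sub>R (0::'k)" for z
      using real[rule_format, of z] by (auto simp: of_real_def)
  qed auto
next
  assume "\<exists>u::'k. u * u = -1 \<and> inner u 1 = 0 \<and> norm u = 1 \<and>
     (\<forall>z. \<exists>b. z = of_real (kre z) + of_real b * u)"
  then obtain u :: 'k where u: "u * u = -1" "inner u 1 = 0" "norm u = 1"
    and ex: "\<And>z. \<exists>b. z = of_real (kre z) + of_real b * u" by blast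
  show thesis
  proof (rule that[of u])
    show "\<exists>r x. z = r *\<^sub>R 1 + x *\<^sub>R u" for z
      using ex[of z] by (metis of_real_def scaleR_conv_of_real)
    show "u * u = - (inner u u *\<^sub>R 1)" using u by (simp add: norm_eq_1)
  qed (rule u)
qed

lemma kre_coordinates: "inner (u::'k::RC_field) 1 = 0 \<Longrightarrow> kre (r *\<^sub>R 1 + x *\<^sub>R u) = r"
  by (simp add: kre_def inner_add_left RC_field_inner_1_1)

lemma kcnj_coordinates:
  "inner (u::'k::RC_field) 1 = 0 \<Longrightarrow> kcnj (r *\<^sub>R 1 + x *\<^sub>R u) = r *\<^sub>R 1 - x *\<^sub>R u"
  by (simp add: kcnj_def kre_coordinates of_real_def algebra_simps scaleR_2)

lemma inner_coordinates:
  "inner (u::'k::RC_field) 1 = 0 \<Longrightarrow>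
   inner (r *\<^sub>R 1 + x *\<^sub>R u) (s *\<^sub>R 1 + y *\<^sub>R u) = r * s + x * y * inner u u"
  by (simp add: inner_add_left inner_add_right RC_field_inner_1_1 inner_commute[of 1 u])

lemma mult_coordinates:
  "(u::'k::RC_field) * u = - (n *\<^sub>R 1) \<Longrightarrow>
   (r *\<^sub>R 1 + x *\<^sub>R u) * (s *\<^sub>R 1 + y *\<^sub>R u) = (r * s - x * y * n) *\<^sub>R 1 + (r * y + x * s) *\<^sub>R u"
  by (simp add: algebra_simps)

lemma kre_kcnj_mult: "kre (kcnj a * b) = inner a (b::'k::RC_field)"
proof -
  obtain u :: 'k where u: "inner u 1 = 0" "u * u = - (inner u u *\<^sub>R 1)"
    and ex: "\<And>z. \<exists>r x. z = r *\<^sub>R 1 + x *\<^sub>R u"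
    using RC_field_coordinates by blast
  obtain r x s y where ab: "a = r *\<^sub>R 1 + x *\<^sub>R u" "b = s *\<^sub>R 1 + y *\<^sub>R u"
    using ex by meson
  have "kcnj a = r *\<^sub>R 1 + (- x) *\<^sub>R u" using kcnj_coordinates[OF u(1)] by (simp add: ab(1))
  then show ?thesis
    by (simp only: ab(2) mult_coordinates[OF u(2)] kre_coordinates[OF u(1)])
       (simp add: ab(1) inner_coordinates[OF u(1)])
qed

lemma inner_kcnj_mult_left: "inner (kcnj a * b) c = inner b (a * (c::'k::RC_field))"
proof -
  obtain u :: 'k where u: "inner u 1 = 0" "u * u = - (inner u u *\<^sub>R 1)"
    and ex: "\<And>z. \<exists>r x. z = r *\<^sub>R 1 + x *\<^sub>R u"
    using RC_field_coordinates by blast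
  obtain r x s y p z where abc: "a = r *\<^sub>R 1 + x *\<^sub>R u" "b = s *\<^sub>R 1 + y *\<^sub>R u" "c = p *\<^sub>R 1 + z *\<^sub>R u"
    using ex by meson
  have "kcnj a = r *\<^sub>R 1 + (- x) *\<^sub>R u" using kcnj_coordinates[OF u(1)] by (simp add: abc(1))
  then have "inner (kcnj a * b) c = (r * s - - x * y * inner u u) * p + (r * y + - x * s) * z * inner u u"
    by (simp only: abc mult_coordinates[OF u(2)] inner_coordinates[OF u(1)])
  also have "\<dots> = s * (r * p - x * z * inner u u) + y * (r * z + x * p) * inner u u"
    by (simp add: algebra_simps)
  also have "\<dots> = inner b (a * c)"
    by (simp only: abc mult_coordinates[OF u(2)] inner_coordinates[OF u(1)])
  finally show ?thesis .
qed

lemma kre_add: "kre (a + b) = kre a + kre b"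
  by (simp add: kre_def inner_add_left)

lemma kre_of_real: "kre (of_real r :: 'k::RC_field) = r"
  by (simp add: kre_def of_real_def RC_field_inner_1_1)

lemma bounded_linear_kre: "bounded_linear kre"
  unfolding kre_def by (rule bounded_linear_inner_left)

text \<open>
  The real part of the inner product is the Euclidean inner product of the type, so that real
  parts of energies can be computed with the real Hilbert space structure of \<open>L\<^sub>2\<close>.
\<close>

lemma kre_kip: "kre (kip x y) = inner x (y :: 'k::RC_field ^ 'i)"
  unfolding kip_def by (simp add: linear_sum[OF bounded_linear.linear[OF bounded_linear_kre]]
      kre_kcnj_mult inner_vec_def)

lemma inner_kadj_mult:
  fixes A :: "'k::RC_field ^ 'i ^ 'j"
  shows "inner (kadj A *v x) y = inner x (A *v y)"
proof -
  have "inner (kadj A *v x) y = (\<Sum>i\<in>UNIV. \<Sum>j\<in>UNIV. inner (kcnj (A $ j $ i) * x $ j) (y $ i))"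
    by (simp add: inner_vec_def kadj_def matrix_vector_mult_def inner_sum_left)
  also have "\<dots> = (\<Sum>i\<in>UNIV. \<Sum>j\<in>UNIV. inner (x $ j) (A $ j $ i * y $ i))"
    by (simp only: inner_kcnj_mult_left)
  also have "\<dots> = (\<Sum>j\<in>UNIV. \<Sum>i\<in>UNIV. inner (x $ j) (A $ j $ i * y $ i))"
    by (rule sum.swap)
  also have "\<dots> = inner x (A *v y)"
    by (simp add: inner_vec_def matrix_vector_mult_def inner_sum_right)
  finally show ?thesis .
qed

lemma bounded_bilinear_kip: "bounded_bilinear (kip :: 'k::RC_field ^ 'i \<Rightarrow> 'k ^ 'i \<Rightarrow> 'k)"
proof -
  have add: "kcnj (a + b) = kcnj a + kcnj b" and scale: "kcnj (r *\<^sub>R a) = r *\<^sub>R kcnj a"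
    for a b :: 'k and r
    by (simp_all add: kcnj_def kre_def inner_add_left of_real_def algebra_simps)
  have "bilinear (kip :: 'k ^ 'i \<Rightarrow> 'k ^ 'i \<Rightarrow> 'k)"
    unfolding bilinear_def
    by (intro allI conjI linearI)
       (simp_all add: kip_def add scale algebra_simps sum.distrib scaleR_sum_right)
  then show ?thesis by (simp add: bilinear_conv_bounded_bilinear)
qed

lemma bounded_bilinear_matrix_vector_mult:
  "bounded_bilinear ((*v) :: 'k::RC_field ^ 'i ^ 'j \<Rightarrow> 'k ^ 'i \<Rightarrow> 'k ^ 'j)"
proof -
  have "bilinear ((*v) :: 'k::RC_field ^ 'i ^ 'j \<Rightarrow> 'k ^ 'i \<Rightarrow> 'k ^ 'j)"
    unfolding bilinear_def
    by (intro allI conjI linearI)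
       (simp_all add: vec_eq_iff matrix_vector_mult_def algebra_simps sum.distrib scaleR_sum_right)
  then show ?thesis by (simp add: bilinear_conv_bounded_bilinear)
qed

lemma borel_measurable_bounded_bilinear:
  fixes h :: "'a::euclidean_space \<Rightarrow> 'b::euclidean_space \<Rightarrow> 'c::real_normed_vector"
  assumes h: "bounded_bilinear h" and "f \<in> borel_measurable M" "g \<in> borel_measurable M"
  shows "(\<lambda>s. h (f s) (g s)) \<in> borel_measurable M"
  by (rule borel_measurable_continuous_Pair[OF assms(2,3)])
     (intro bounded_bilinear.continuous_on[OF h] continuous_intros)

lemma square_integrable_bilinear:
  fixes h :: "'a::euclidean_space \<Rightarrow> 'b::euclidean_space \<Rightarrow> 'c::euclidean_space"
  assumes h: "bounded_bilinear h" and f: "square_integrable M f" and g: "square_integrable M g"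
  shows "integrable M (\<lambda>s. h (f s) (g s))"
proof -
  obtain K where K: "K > 0" "\<And>a b. norm (h a b) \<le> norm a * norm b * K"
    using bounded_bilinear.pos_bounded[OF h] by blast
  have meas: "f \<in> borel_measurable M" "g \<in> borel_measurable M"
    and i: "integrable M (\<lambda>s. (norm (f s))\<^sup>2)" "integrable M (\<lambda>s. (norm (g s))\<^sup>2)"
    using f g by (auto simp: square_integrable_def)
  show ?thesis
  proof (rule Bochner_Integration.integrable_bound
          [where f = "\<lambda>s. K * ((norm (f s))\<^sup>2 + (norm (g s))\<^sup>2)"])
    show "integrable M (\<lambda>s. K * ((norm (f s))\<^sup>2 + (norm (g s))\<^sup>2))" using i by simp
    show "(\<lambda>s. h (f s) (g s)) \<in> borel_measurable M"
      by (rule borel_measurable_bounded_bilinear[OF h meas])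
    have "norm (h (f s) (g s)) \<le> K * ((norm (f s))\<^sup>2 + (norm (g s))\<^sup>2)" for s
    proof -
      have "0 \<le> norm (f s) * norm (g s)" by simp
      then have "norm (f s) * norm (g s) \<le> (norm (f s))\<^sup>2 + (norm (g s))\<^sup>2"
        using sum_squares_bound[of "norm (f s)" "norm (g s)"] by linarith
      then have "norm (f s) * norm (g s) * K \<le> ((norm (f s))\<^sup>2 + (norm (g s))\<^sup>2) * K"
        using K(1) by (intro mult_right_mono) auto
      then show ?thesis using K(2)[of "f s" "g s"] by (simp add: mult.commute)
    qed
    then show "AE s in M. norm (h (f s) (g s)) \<le> norm (K * ((norm (f s))\<^sup>2 + (norm (g s))\<^sup>2))"
      using K(1) by (auto intro!: AE_I2 order_trans[OF _ abs_ge_self])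
  qed
qed

lemma L2_rel_rep: "L2_rel (rep_L2 x) (rep_L2 x)"
  by (rule Quotient_rep_reflp[OF Quotient_L2])

lemma square_integrable_rep: "square_integrable I01 (rep_L2 x)"
  using L2_rel_rep[of x] by (simp add: L2_rel_def)

lemma AE_rep_abs_L2:
  assumes "square_integrable I01 f"
  shows "AE s in I01. rep_L2 (abs_L2 f) s = f s"
proof -
  have "L2_rel (rep_L2 (abs_L2 f)) f"
    using assms by (intro Quotient_rep_abs[OF Quotient_L2]) (simp add: L2_rel_def)
  then show ?thesis by (simp add: L2_rel_def)
qed

lemma L2_eqI:
  assumes "AE s in I01. rep_L2 x s = rep_L2 y s"
  shows "x = y"
  using assms Quotient_rel_rep[OF Quotient_L2, of x y] square_integrable_rep
  by (auto simp: L2_rel_def)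

lemma AE_rep_plus: "AE s in I01. rep_L2 (x + y) s = rep_L2 x s + rep_L2 y s"
  unfolding plus_L2_def map_fun_def comp_def id_def
  by (rule AE_rep_abs_L2) (intro square_integrable_add square_integrable_rep)

lemma AE_rep_scaleR: "AE s in I01. rep_L2 (r *\<^sub>R x) s = r *\<^sub>R rep_L2 x s"
  unfolding scaleR_L2_def map_fun_def comp_def id_def
  by (rule AE_rep_abs_L2) (intro square_integrable_scaleR square_integrable_rep)

lemma inner_L2_eq: "inner x y = (LINT s|I01. inner (rep_L2 x s) (rep_L2 y s))"
  by (simp add: inner_L2_def)

lemma norm_L2_eq: "(norm x)\<^sup>2 = (LINT s|I01. (norm (rep_L2 x s))\<^sup>2)"
  by (simp add: power2_norm_eq_inner inner_L2_eq)

lemma norm_squared_le_mult: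
  "norm a \<le> K * norm b \<Longrightarrow> (norm a)\<^sup>2 \<le> K\<^sup>2 * (norm b)\<^sup>2"
  by (metis norm_ge_zero power_mono power_mult_distrib)

text \<open>
  Multiplication by \<open>F\<close> is a bounded operator on \<open>L\<^sub>2\<close>, and \<open>mul_L2\<close>, which is computed from
  chosen representatives, agrees with it almost everywhere.
\<close>

locale essentially_bounded_multiplier =
  fixes F :: "real \<Rightarrow> 'k::RC_field ^ 'd ^ 'd" and C :: real
  assumes measurable: "F \<in> borel_measurable I01"
    and bounded: "AE s in I01. norm (F s) \<le> C"
begin

lemma mult_bound:
  obtains K where "K > 0" "\<And>v. AE s in I01. norm (F s *v v s) \<le> K * norm (v s)"
proof -
  obtain K where K: "K > 0" "\<And>(A::'k^'d^'d) v. norm (A *v v) \<le> norm A * norm v * K"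
    using bounded_bilinear.pos_bounded[OF bounded_bilinear_matrix_vector_mult] by blast
  show thesis
  proof (rule that[of "max 1 C * K"])
    show "max 1 C * K > 0" using K by simp
    fix v :: "real \<Rightarrow> 'k ^ 'd"
    show "AE s in I01. norm (F s *v v s) \<le> max 1 C * K * norm (v s)"
      using bounded
    proof (rule AE_mp, intro AE_I2 impI)
      fix s assume "norm (F s) \<le> C"
      then have "norm (F s) * (norm (v s) * K) \<le> max 1 C * (norm (v s) * K)"
        using K by (intro mult_right_mono) auto
      then show "norm (F s *v v s) \<le> max 1 C * K * norm (v s)"
        using K(2)[of "F s" "v s"] by (simp add: algebra_simps)
    qed
  qed
qed

lemma square_integrable_mult:
  assumes f: "square_integrable I01 f"
  shows "square_integrable I01 (\<lambda>s. F s *v f s)"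
proof -
  obtain K where K: "K > 0" "\<And>v. AE s in I01. norm (F s *v v s) \<le> K * norm (v s)"
    using mult_bound by blast
  have meas: "(\<lambda>s. F s *v f s) \<in> borel_measurable I01"
    using f by (intro borel_measurable_bounded_bilinear[OF bounded_bilinear_matrix_vector_mult]
        measurable) (simp add: square_integrable_def)
  moreover have "integrable I01 (\<lambda>s. (norm (F s *v f s))\<^sup>2)"
  proof (rule Bochner_Integration.integrable_bound[where f = "\<lambda>s. K\<^sup>2 * (norm (f s))\<^sup>2"])
    show "integrable I01 (\<lambda>s. K\<^sup>2 * (norm (f s))\<^sup>2)" using f by (simp add: square_integrable_def)
    show "(\<lambda>s. (norm (F s *v f s))\<^sup>2) \<in> borel_measurable I01" using meas by measurable
    show "AE s in I01. norm ((norm (F s *v f s))\<^sup>2) \<le> norm (K\<^sup>2 * (norm (f s))\<^sup>2)"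
      using K(2)[of f]
      by eventually_elim (simp add: norm_squared_le_mult)
  qed
  ultimately show ?thesis by (simp add: square_integrable_def)
qed

lemma AE_rep_mul: "AE s in I01. rep_L2 (mul_L2 F x) s = F s *v rep_L2 x s"
  unfolding mul_L2_def by (intro AE_rep_abs_L2 square_integrable_mult square_integrable_rep)

lemma bounded_linear_mul: "bounded_linear (mul_L2 F)"
proof -
  note bb = bounded_bilinear_matrix_vector_mult
  obtain K where K: "K > 0" "\<And>v. AE s in I01. norm (F s *v v s) \<le> K * norm (v s)"
    using mult_bound by blast
  show ?thesis
  proof (rule bounded_linear_intro)
    fix x y :: "('k ^ 'd) L2" and r :: real
    show "mul_L2 F (x + y) = mul_L2 F x + mul_L2 F y"
      using AE_rep_mul[of "x + y"] AE_rep_mul[of x] AE_rep_mul[of y]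
        AE_rep_plus[of x y] AE_rep_plus[of "mul_L2 F x" "mul_L2 F y"]
      by (intro L2_eqI, eventually_elim) (simp add: bounded_bilinear.add_right[OF bb])
    show "mul_L2 F (r *\<^sub>R x) = r *\<^sub>R mul_L2 F x"
      using AE_rep_mul[of "r *\<^sub>R x"] AE_rep_mul[of x]
        AE_rep_scaleR[of r x] AE_rep_scaleR[of r "mul_L2 F x"]
      by (intro L2_eqI, eventually_elim) (simp add: bounded_bilinear.scaleR_right[OF bb])
    have "(norm (mul_L2 F x))\<^sup>2 \<le> (LINT s|I01. K\<^sup>2 * (norm (rep_L2 x s))\<^sup>2)"
      unfolding norm_L2_eq
    proof (rule integral_mono_AE)
      show "integrable I01 (\<lambda>s. (norm (rep_L2 (mul_L2 F x) s))\<^sup>2)"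
        "integrable I01 (\<lambda>s. K\<^sup>2 * (norm (rep_L2 x s))\<^sup>2)"
        using square_integrable_rep[of x] square_integrable_rep[of "mul_L2 F x"]
        by (auto simp: square_integrable_def)
      show "AE s in I01. (norm (rep_L2 (mul_L2 F x) s))\<^sup>2 \<le> K\<^sup>2 * (norm (rep_L2 x s))\<^sup>2"
        using AE_rep_mul[of x] K(2)[of "rep_L2 x"]
        by eventually_elim (simp add: norm_squared_le_mult)
    qed
    also have "\<dots> = (norm x * K)\<^sup>2" by (simp add: norm_L2_eq power_mult_distrib)
    finally show "norm (mul_L2 F x) \<le> norm x * K"
      by (rule power2_le_imp_le) (use K in simp)
  qed
qed

lemma kre_ip_H: "kre (ip_H F x y) = inner x (mul_L2 F y)"
  unfolding ip_H_def kip_L2_def inner_L2_eq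
  by (subst integral_bounded_linear[OF bounded_linear_kre, symmetric])
     (simp_all add: kre_kip square_integrable_bilinear[OF bounded_bilinear_kip]
        square_integrable_rep)

lemma kre_ip_H_pointwise:
  "kre (ip_H F x y) = (LINT s|I01. inner (rep_L2 x s) (F s *v rep_L2 y s))"
proof -
  have "(LINT s|I01. inner (rep_L2 x s) (rep_L2 (mul_L2 F y) s))
      = (LINT s|I01. inner (rep_L2 x s) (F s *v rep_L2 y s))"
  proof (rule integral_cong_AE)
    show "AE s in I01. inner (rep_L2 x s) (rep_L2 (mul_L2 F y) s) = inner (rep_L2 x s) (F s *v rep_L2 y s)"
      using AE_rep_mul[of y] by eventually_elim simp
  qed (use square_integrable_rep square_integrable_mult in
      \<open>auto simp: square_integrable_def intro!: borel_measurable_inner\<close>)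
  then show ?thesis by (simp add: kre_ip_H inner_L2_eq)
qed

end

lemma port_hamiltonian_multiplier:
  assumes "port_hamiltonian N P H"
  obtains C where "essentially_bounded_multiplier H C"
  using assms by (auto simp: port_hamiltonian_def essentially_bounded_multiplier_def)

lemma bounded_bilinear_energy:
  assumes "port_hamiltonian N P H"
  shows "bounded_bilinear (\<lambda>x y. kre (ip_H H x y))"
proof -
  obtain C where "essentially_bounded_multiplier H C"
    using port_hamiltonian_multiplier[OF assms] .
  then interpret essentially_bounded_multiplier H C .
  show ?thesis unfolding kre_ip_H
    by (rule bounded_bilinear.comp[OF bounded_bilinear_inner bounded_linear_ident bounded_linear_mul])
qed

lemma energy_commute:
  assumes "port_hamiltonian N P H"
  shows "kre (ip_H H x y) = kre (ip_H H y x)"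
proof -
  obtain C where "essentially_bounded_multiplier H C"
    using port_hamiltonian_multiplier[OF assms] .
  then interpret essentially_bounded_multiplier H C .
  have "AE s in I01. kadj (H s) = H s" using assms by (simp add: port_hamiltonian_def)
  then have "AE s in I01. inner (rep_L2 x s) (H s *v rep_L2 y s) = inner (rep_L2 y s) (H s *v rep_L2 x s)"
    by eventually_elim (metis inner_kadj_mult inner_commute)
  then show ?thesis unfolding kre_ip_H_pointwise
    by (intro integral_cong_AE) (use square_integrable_rep square_integrable_mult in
      \<open>auto simp: square_integrable_def intro!: borel_measurable_inner\<close>)
qed

lemma energy_coercive:
  assumes "port_hamiltonian N P H"
  obtains m where "m > 0" "\<And>x. m * (norm x)\<^sup>2 \<le> kre (ip_H H x x)"
proof -
  obtain C where "essentially_bounded_multiplier H C"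
    using port_hamiltonian_multiplier[OF assms] .
  then interpret essentially_bounded_multiplier H C .
  obtain m where m: "m > 0" "AE s in I01. \<forall>v. kre (kip v (H s *v v)) \<ge> m * (norm v)\<^sup>2"
    using assms by (auto simp: port_hamiltonian_def)
  have "m * (norm x)\<^sup>2 \<le> kre (ip_H H x x)" for x
  proof -
    have "(LINT s|I01. m * (norm (rep_L2 x s))\<^sup>2) \<le> kre (ip_H H x x)"
      unfolding kre_ip_H_pointwise
    proof (rule integral_mono_AE)
      show "integrable I01 (\<lambda>s. m * (norm (rep_L2 x s))\<^sup>2)"
        using square_integrable_rep[of x] by (simp add: square_integrable_def)
      show "integrable I01 (\<lambda>s. inner (rep_L2 x s) (H s *v rep_L2 x s))"
        by (intro square_integrable_inner square_integrable_mult square_integrable_rep)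
      show "AE s in I01. m * (norm (rep_L2 x s))\<^sup>2 \<le> inner (rep_L2 x s) (H s *v rep_L2 x s)"
        using m(2) by eventually_elim (simp add: kre_kip)
    qed
    then show ?thesis by (simp add: norm_L2_eq)
  qed
  with m(1) show thesis by (rule that)
qed

section \<open>Lipschitz trajectories and their derivatives\<close>

lemma difference_quotient_LIMSEQ:
  fixes x :: "real \<Rightarrow> 'a::real_normed_vector"
  assumes "(x has_vector_derivative D) (at t)"
  shows "(\<lambda>n. real (Suc n) *\<^sub>R (x (t + 1 / real (Suc n)) - x t)) \<longlonglongrightarrow> D"
proof -
  define s where "s n = 1 / real (Suc n)" for n
  have lim: "((\<lambda>h. norm (x (t + h) - x t - h *\<^sub>R D) / norm h) \<longlongrightarrow> 0) (at 0)"
    using assms unfolding has_vector_derivative_def has_derivative_at by blast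
  have s0: "s \<longlonglongrightarrow> 0" unfolding s_def by (rule LIMSEQ_Suc) (rule lim_1_over_n)
  have "filterlim s (at 0) sequentially"
    using s0 by (auto simp: filterlim_at s_def)
  from filterlim_compose[OF lim this]
  have "(\<lambda>n. norm (x (t + s n) - x t - s n *\<^sub>R D) / norm (s n)) \<longlonglongrightarrow> 0" .
  moreover have "norm (x (t + s n) - x t - s n *\<^sub>R D) / norm (s n)
      = norm (real (Suc n) *\<^sub>R (x (t + s n) - x t) - D)" for n
  proof -
    have "real (Suc n) *\<^sub>R (x (t + s n) - x t) - D = real (Suc n) *\<^sub>R (x (t + s n) - x t - s n *\<^sub>R D)"
      by (simp add: s_def scaleR_diff_right)
    moreover have "norm (s n) = 1 / real (Suc n)" by (simp add: s_def)
    ultimately show ?thesis by (simp only: norm_scaleR) simp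
  qed
  ultimately have "(\<lambda>n. norm (real (Suc n) *\<^sub>R (x (t + s n) - x t) - D)) \<longlonglongrightarrow> 0" by simp
  then have "(\<lambda>n. real (Suc n) *\<^sub>R (x (t + s n) - x t) - D) \<longlonglongrightarrow> 0"
    by (rule tendsto_norm_zero_cancel)
  then show ?thesis unfolding s_def by (rule LIM_zero_cancel)
qed

lemma lipschitz_on_derivative_bound:
  fixes x :: "real \<Rightarrow> 'a::real_normed_vector"
  assumes lip: "L-lipschitz_on {0..} x" and t: "t \<ge> 0"
    and D: "(x has_vector_derivative D) (at t)"
  shows "norm D \<le> L"
proof (rule Lim_bounded[OF tendsto_norm[OF difference_quotient_LIMSEQ[OF D]], of 0], intro allI impI)
  fix n :: nat
  have "norm (x (t + 1 / real (Suc n)) - x t) \<le> L * (1 / real (Suc n))"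
    using lipschitz_onD[OF lip, of "t + 1 / real (Suc n)" t] t by (simp add: dist_norm)
  then have "real (Suc n) * norm (x (t + 1 / real (Suc n)) - x t) \<le> real (Suc n) * (L * (1 / real (Suc n)))"
    by (intro mult_left_mono) auto
  also have "\<dots> = L" by simp
  finally show "norm (real (Suc n) *\<^sub>R (x (t + 1 / real (Suc n)) - x t)) \<le> L" by simp
qed

text \<open>
  A derivative is a limit of continuous difference quotients, hence measurable; changing it on a
  null set is harmless because Lebesgue measure is complete.  The pairs are approximated as a whole
  since in a nonseparable product a map with measurable components may fail to be measurable.
\<close>

lemma borel_measurable_pair_derivative:
  fixes x :: "real \<Rightarrow> 'a::real_normed_vector"
  assumes cont: "continuous_on {0..} x" and E: "negligible E"
    and D: "\<And>t. t > 0 \<Longrightarrow> t \<notin> E \<Longrightarrow> (x has_vector_derivative D t) (at t)"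
  shows "(\<lambda>t. (x t, D t)) \<in> borel_measurable (lebesgue_on {0..})"
proof -
  define G where "G = insert 0 E"
  have G: "negligible G" using E by (simp add: G_def)
  then have Gs: "G \<in> sets lebesgue" by (rule negligible_imp_sets)
  define u where "u n t = (x t, real (Suc n) *\<^sub>R (x (t + 1 / real (Suc n)) - x t))" for n t
  define v where "v t = (if t \<in> G then 0 else (x t, D t))" for t
  have u: "u n \<in> borel_measurable (lebesgue_on {0..})" for n
  proof (rule continuous_imp_measurable_on_sets_lebesgue)
    have "continuous_on {0..} (\<lambda>t. x (t + 1 / real (Suc n)))"
      by (rule continuous_on_compose2[OF cont]) (auto intro!: continuous_intros)
    then show "continuous_on {0..} (u n)"
      unfolding u_def by (intro continuous_intros cont)
  qed simp
  have GI: "G \<inter> space (lebesgue_on {0..}) \<in> sets (lebesgue_on {0..})"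
    using Gs by (auto simp: sets_restrict_space)
  have v: "v \<in> borel_measurable (lebesgue_on {0..})"
  proof (rule borel_measurable_LIMSEQ_metric)
    show "(\<lambda>t. if t \<in> G then 0 else u n t) \<in> borel_measurable (lebesgue_on {0..})" for n
      by (intro measurable_If_set u GI) simp
    fix t assume t: "t \<in> space (lebesgue_on {0::real..})"
    show "(\<lambda>n. if t \<in> G then 0 else u n t) \<longlonglongrightarrow> v t"
    proof (cases "t \<in> G")
      case False
      then have "(x has_vector_derivative D t) (at t)" using t D[of t] by (auto simp: G_def)
      then have "(\<lambda>n. u n t) \<longlonglongrightarrow> (x t, D t)"
        unfolding u_def by (intro tendsto_Pair tendsto_const difference_quotient_LIMSEQ)
      then show ?thesis using False by (simp add: v_def)
    qed (simp add: v_def)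
  qed
  show ?thesis
  proof (rule measurableI)
    fix B :: "('a \<times> 'a) set" assume "B \<in> sets borel"
    then have "v -` B \<inter> {0..} \<in> sets (lebesgue_on {0..})"
      using measurable_sets[OF v] by simp
    then have "v -` B \<inter> {0..} \<in> sets lebesgue" by (simp add: sets_restrict_space_iff)
    moreover have "(\<lambda>t. (x t, D t)) -` B \<inter> {0..} \<inter> G \<in> sets lebesgue"
      by (rule negligible_imp_sets) (rule negligible_subset[OF G], blast)
    moreover have "(\<lambda>t. (x t, D t)) -` B \<inter> {0..}
        = (v -` B \<inter> {0..} - G) \<union> ((\<lambda>t. (x t, D t)) -` B \<inter> {0..} \<inter> G)"
      by (auto simp: v_def)
    ultimately have "(\<lambda>t. (x t, D t)) -` B \<inter> {0..} \<in> sets lebesgue"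
      using Gs by (metis sets.Diff sets.Un)
    then show "(\<lambda>t. (x t, D t)) -` B \<inter> space (lebesgue_on {0..}) \<in> sets (lebesgue_on {0..})"
      by (simp add: sets_restrict_space_iff)
  qed simp
qed

text \<open>
  The bound for \<open>q(x)\<close> holds for its absolutely continuous representative only up to a null set;
  continuity removes the exception.
\<close>

lemma AE_halfline_le_imp_le:
  fixes f g :: "real \<Rightarrow> real"
  assumes f: "\<And>T. continuous_on {0..T} f" and g: "\<And>T. continuous_on {0..T} g"
    and ae: "AE t in lebesgue_on {0..}. f t \<le> g t" and t: "t \<ge> 0"
  shows "f t \<le> g t"
proof (rule ccontr)
  assume "\<not> f t \<le> g t"
  then have pos: "f t - g t > 0" by simp
  obtain E where E: "negligible E" "\<forall>t\<ge>0. t \<notin> E \<longrightarrow> f t \<le> g t"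
    using AE_halfline_imp_negligible[OF ae] by blast
  have "continuous_on {0..t+1} (\<lambda>s. f s - g s)" by (intro continuous_intros f g)
  moreover have "t \<in> {0..t+1}" using t by simp
  ultimately obtain d where d: "d > 0"
    "\<forall>s\<in>{0..t+1}. dist s t < d \<longrightarrow> dist (f s - g s) (f t - g t) < f t - g t"
    using pos unfolding continuous_on_iff by blast
  have "{t<..<t + min d 1} \<subseteq> E"
  proof
    fix s assume s: "s \<in> {t<..<t + min d 1}"
    then have "dist (f s - g s) (f t - g t) < f t - g t"
      using t by (intro d(2)[rule_format]) (auto simp: dist_real_def)
    then have "f s > g s" by (auto simp: dist_real_def)
    then show "s \<in> E" using E(2)[rule_format, of s] s t by force
  qed
  then have "negligible {t<..<t + min d 1}" by (rule negligible_subset[OF E(1)])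
  moreover have "\<not> negligible {t<..<t + min d 1}"
    using d(1) by (intro open_not_negligible) auto
  ultimately show False by blast
qed

lemma abs_continuous_halfline_imp_continuous_on:
  assumes "abs_continuous_halfline f"
  shows "continuous_on {0..T} f"
proof (cases "T > 0")
  case True
  then show ?thesis
    using assms by (auto simp: abs_continuous_halfline_def intro: abs_continuous_on_imp_continuous_on)
next
  case False
  then show ?thesis
    by (cases "T = 0") auto
qed

section \<open>Exponential decay from a Lyapunov function\<close>

lemma abs_continuous_on_exp:
  "abs_continuous_on 0 T (\<lambda>t::real. exp (\<kappa> * t) :: real)"
proof -
  define B where "B = \<bar>\<kappa>\<bar> * exp (\<bar>\<kappa>\<bar> * \<bar>T\<bar>)"
  have "B-lipschitz_on {0..T} (\<lambda>t. exp (\<kappa> * t))"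
  proof (rule lipschitz_onI)
    fix s t assume st: "s \<in> {0..T}" "t \<in> {0..T}"
    have "norm (exp (\<kappa> * s) - exp (\<kappa> * t)) \<le> B * norm (s - t)"
    proof (rule field_differentiable_bound[of "{0..T}" _ "\<lambda>r. exp (\<kappa> * r) * \<kappa>"])
      fix r assume r: "r \<in> {0..T}"
      show "((\<lambda>t. exp (\<kappa> * t)) has_field_derivative exp (\<kappa> * r) * \<kappa>) (at r within {0..T})"
        by (auto intro!: derivative_eq_intros)
      have "\<kappa> * r \<le> \<bar>\<kappa>\<bar> * \<bar>T\<bar>"
        using r by (metis abs_ge_self abs_mult abs_of_nonneg atLeastAtMost_iff mult_left_mono
            abs_ge_zero order_trans)
      then show "norm (exp (\<kappa> * r) * \<kappa>) \<le> B"
        by (simp add: B_def abs_mult mult.commute mult_left_mono)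
    qed (use st in auto)
    then show "dist (exp (\<kappa> * s)) (exp (\<kappa> * t)) \<le> B * dist s t" by (simp add: dist_norm)
  qed (simp add: B_def)
  then show ?thesis by (rule lipschitz_on_imp_abs_continuous_on)
qed

text \<open>
  In the application \<open>n = \<parallel>x\<parallel>\<^sup>2\<close> is the part of the energy that is not dissipated directly, \<open>h\<close> is
  the part that is, and \<open>p\<close> is \<open>q\<close> along the orbit.  The function \<open>V = \<phi> + \<epsilon> p\<close> satisfies
  \<open>\<phi>/2 \<le> V \<le> 3\<phi>/2\<close> and \<open>V' \<le> - \<epsilon>\<phi> \<le> - (2\<epsilon>/3) V\<close>, so that \<open>exp (2\<epsilon>t/3) V t\<close> does not increase.
\<close>

lemma lyapunov_exponential_decay:
  fixes \<phi> p :: "real \<Rightarrow> real"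
  assumes \<phi>: "abs_continuous_halfline \<phi>" and p: "abs_continuous_halfline p"
    and nonneg: "\<And>t. t \<ge> 0 \<Longrightarrow> 0 \<le> \<phi> t"
    and p_bound: "\<And>t. t \<ge> 0 \<Longrightarrow> \<bar>p t\<bar> \<le> k * \<phi> t"
    and ae: "AE t in lebesgue_on {0..}. \<exists>D D' n h. 0 \<le> h \<and> \<phi> t \<le> n + h \<and>
       (\<phi> has_real_derivative D) (at t) \<and> D \<le> - a * h \<and>
       (p has_real_derivative D') (at t) \<and> n + D' \<le> b * h"
    and \<epsilon>: "\<epsilon> > 0" "\<epsilon> * (b + 1) \<le> a" "2 * \<epsilon> * k \<le> 1"
    and T: "T \<ge> 0"
  shows "\<phi> T \<le> 3 * exp (- (2 * \<epsilon> / 3) * T) * \<phi> 0"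
proof -
  define V where "V t = \<phi> t + \<epsilon> * p t" for t
  have V: "\<phi> t \<le> 2 * V t" "2 * V t \<le> 3 * \<phi> t" if "t \<ge> 0" for t
  proof -
    have "\<bar>2 * \<epsilon> * p t\<bar> \<le> 2 * \<epsilon> * (k * \<phi> t)"
      using \<epsilon>(1) p_bound[OF that] by (simp add: abs_mult)
    also have "\<dots> \<le> \<phi> t"
      using mult_right_mono[OF \<epsilon>(3) nonneg[OF that]] by (simp add: algebra_simps)
    finally show "\<phi> t \<le> 2 * V t" "2 * V t \<le> 3 * \<phi> t" by (auto simp: V_def abs_le_iff)
  qed
  define \<kappa> where "\<kappa> = 2 * \<epsilon> / 3"
  define F where "F t = exp (\<kappa> * t) * V t" for t
  have "F T \<le> F 0"
  proof (cases "T > 0")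
    case True
    obtain E where E: "negligible E" "\<forall>t\<ge>0. t \<notin> E \<longrightarrow> (\<exists>D D' n h. 0 \<le> h \<and> \<phi> t \<le> n + h \<and>
       (\<phi> has_real_derivative D) (at t) \<and> D \<le> - a * h \<and>
       (p has_real_derivative D') (at t) \<and> n + D' \<le> b * h)"
      using AE_halfline_imp_negligible[OF ae] by blast
    have ac: "abs_continuous_on 0 T \<phi>" "abs_continuous_on 0 T p"
      using \<phi> p True by (auto simp: abs_continuous_halfline_def)
    have "abs_continuous_on 0 T (\<lambda>t. \<epsilon> * p t)"
      by (rule bounded_bilinear.abs_continuous_on[OF bounded_bilinear_mult _ ac(2)])
         (rule lipschitz_on_imp_abs_continuous_on[OF lipschitz_on_constant])
    then have "abs_continuous_on 0 T V"
      unfolding V_def by (rule abs_continuous_on_add[OF ac(1)])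
    then have F: "abs_continuous_on 0 T F"
      unfolding F_def
      by (rule bounded_bilinear.abs_continuous_on[OF bounded_bilinear_mult abs_continuous_on_exp])
    show ?thesis
    proof (rule abs_continuous_on_deriv_nonpos_imp_le[OF F T E(1)])
      fix t assume "t \<in> {0..T} - E"
      then have t: "t \<ge> 0" "t \<notin> E" by auto
      obtain D D' n h where *: "0 \<le> h" "\<phi> t \<le> n + h" "(\<phi> has_real_derivative D) (at t)" "D \<le> - a * h"
        "(p has_real_derivative D') (at t)" "n + D' \<le> b * h"
        using E(2)[rule_format, OF t] by blast
      have "(F has_real_derivative exp (\<kappa> * t) * (\<kappa> * V t + (D + \<epsilon> * D'))) (at t)"
        unfolding F_def V_def by (rule derivative_eq_intros *(3,5) refl | simp add: algebra_simps)+
      moreover have "\<kappa> * V t + (D + \<epsilon> * D') \<le> 0"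
      proof -
        have "\<kappa> * V t \<le> \<epsilon> * \<phi> t"
          using mult_left_mono[OF V(2)[OF t(1)], of "\<epsilon> / 3"] \<epsilon>(1) by (simp add: \<kappa>_def)
        also have "\<dots> \<le> \<epsilon> * (n + h)" using *(2) \<epsilon>(1) by simp
        finally have "\<kappa> * V t + (D + \<epsilon> * D') \<le> \<epsilon> * (n + h) - a * h + \<epsilon> * (b * h - n)"
          using *(4) mult_left_mono[OF *(6), of \<epsilon>] \<epsilon>(1) by (simp add: algebra_simps)
        also have "\<dots> = (\<epsilon> * (b + 1) - a) * h" by (simp add: algebra_simps)
        also have "\<dots> \<le> 0" using \<epsilon>(2) *(1) by (simp add: mult_nonpos_nonneg)
        finally show ?thesis .
      qed
      ultimately show "\<exists>D\<le>0. (F has_real_derivative D) (at t)"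
        by (metis exp_ge_zero mult_nonneg_nonpos)
    qed
  qed (use T in simp)
  then have "exp (\<kappa> * T) * V T \<le> V 0" by (simp add: F_def)
  then have "V T \<le> exp (- \<kappa> * T) * V 0" by (simp add: exp_minus field_simps)
  then have "\<phi> T \<le> exp (- \<kappa> * T) * (2 * V 0)" using V(1)[OF T] by linarith
  also have "\<dots> \<le> exp (- \<kappa> * T) * (3 * \<phi> 0)" using V(2)[of 0] by (intro mult_left_mono) auto
  finally show ?thesis by (simp add: \<kappa>_def algebra_simps)
qed

section \<open>The energy of the interconnection\<close>

lemma (in hilbert_space_over) kre_ip_self: "kre (ip x x) = (norm x)\<^sup>2"
  by (simp add: ip_self kre_of_real del: of_real_power)

lemma kre_kcnj: "kre (kcnj (a::'k::RC_field)) = kre a"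
  using kre_kcnj_mult[of a 1] by (simp add: kre_def)

text \<open>
  The norm is that of the type and is only known to be induced by \<open>ip\<close>.  Expanding
  \<open>\<parallel>x + y\<parallel>\<^sup>2\<close> shows that the triangle inequality is the Cauchy-Schwarz inequality for the real part.
\<close>

lemma (in hilbert_space_over) bounded_bilinear_kre_ip: "bounded_bilinear (\<lambda>x y. kre (ip x y))"
proof -
  have comm: "kre (ip x y) = kre (ip y x)" for x y
    by (metis ip_commute kre_kcnj)
  have add: "kre (ip x (y + z)) = kre (ip x y) + kre (ip x z)" for x y z
    by (simp add: ip_add_right kre_add)
  have scaleR: "kre (ip x (r *\<^sub>R y)) = r * kre (ip x y)" for x y r
    by (simp add: kre_def inner_commute flip: scale_of_real)
       (simp add: ip_scale_right scaleR_conv_of_real[symmetric])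
  have expand: "(norm (x + y))\<^sup>2 = (norm x)\<^sup>2 + 2 * kre (ip x y) + (norm y)\<^sup>2" for x y
    using comm[of "x + y" x] comm[of "x + y" y] comm[of x y]
    by (simp add: add flip: kre_ip_self)
  have le: "kre (ip x y) \<le> norm x * norm y" for x y
  proof -
    have "(norm (x + y))\<^sup>2 \<le> (norm x + norm y)\<^sup>2" by (intro power_mono norm_triangle_ineq) simp
    then show ?thesis unfolding expand by (simp add: power2_sum)
  qed
  have "\<bar>kre (ip x y)\<bar> \<le> norm x * norm y" for x y
    using le[of x y] le[of x "- y"] scaleR[of x "-1" y] by (simp add: abs_le_iff)
  then show ?thesis
    by unfold_locales
       (auto simp: add scaleR comm[of "_ + _"] comm[of "_ *\<^sub>R _"] comm intro!: exI[of _ 1])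
qed

lemma norm_H_squared:
  assumes "port_hamiltonian N P H"
  shows "(norm_H H x)\<^sup>2 = kre (ip_H H x x)"
proof -
  obtain m where "m > 0" "\<And>x. m * (norm x)\<^sup>2 \<le> kre (ip_H H x x)"
    using energy_coercive[OF assms] by blast
  then have "0 \<le> kre (ip_H H x x)" by (metis less_imp_le mult_nonneg_nonneg order_trans zero_le_power2)
  then show ?thesis by (simp add: norm_H_def)
qed

lemma norm_XXc_squared: "(norm_XXc H z)\<^sup>2 = (norm_H H (fst z))\<^sup>2 + (norm (snd z))\<^sup>2"
  by (simp add: norm_XXc_def)

lemma norm_XXc_nonneg: "0 \<le> norm_XXc H z"
  by (simp add: norm_XXc_def)

lemma continuous_on_norm_XXc:
  assumes "port_hamiltonian N P H"
  shows "continuous_on A (norm_XXc H :: _ \<times> 'c::real_normed_vector \<Rightarrow> real)"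
proof -
  have "continuous_on A (\<lambda>z :: _ \<times> 'c. sqrt (kre (ip_H H (fst z) (fst z)) + (norm (snd z))\<^sup>2))"
    by (intro continuous_intros bounded_bilinear.continuous_on[OF bounded_bilinear_energy[OF assms]])
  then show ?thesis
    by (rule continuous_on_cong[THEN iffD1, rotated 2]) (simp_all add: norm_XXc_def norm_H_squared[OF assms])
qed

text \<open>
  Contractivity of the semigroup refers to the energy norm, continuity and Lipschitz bounds to the
  norm of the product type.
\<close>

lemma norm_XXc_equivalent:
  assumes sys: "port_hamiltonian N P H"
  shows "\<exists>m>0. \<exists>M>0. \<forall>z :: _ \<times> 'c::real_normed_vector.
    m * norm z \<le> norm_XXc H z \<and> norm_XXc H z \<le> M * norm z"
proof -
  obtain \<mu> where \<mu>: "\<mu> > 0" "\<And>x. \<mu> * (norm x)\<^sup>2 \<le> kre (ip_H H x x)"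
    using energy_coercive[OF sys] by blast
  obtain K where K: "K > 0" "\<And>x y. norm (kre (ip_H H x y)) \<le> norm x * norm y * K"
    using bounded_bilinear.pos_bounded[OF bounded_bilinear_energy[OF sys]] by blast
  have sq: "(norm z)\<^sup>2 = (norm (fst z))\<^sup>2 + (norm (snd z))\<^sup>2" for z :: "_ \<times> 'c"
    by (simp add: norm_prod_def)
  have lower: "sqrt (min \<mu> 1) * norm z \<le> norm_XXc H z" for z :: "_ \<times> 'c"
  proof (rule power2_le_imp_le[OF _ norm_XXc_nonneg])
    have "min \<mu> 1 * (norm z)\<^sup>2 \<le> \<mu> * (norm (fst z))\<^sup>2 + 1 * (norm (snd z))\<^sup>2"
      unfolding sq distrib_left by (intro add_mono mult_right_mono) auto
    also have "\<dots> \<le> (norm_XXc H z)\<^sup>2"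
      using \<mu>(2)[of "fst z"] by (simp add: norm_XXc_squared norm_H_squared[OF sys])
    finally show "(sqrt (min \<mu> 1) * norm z)\<^sup>2 \<le> (norm_XXc H z)\<^sup>2"
      using \<mu>(1) by (simp add: power_mult_distrib)
  qed
  have upper: "norm_XXc H z \<le> sqrt (max K 1) * norm z" for z :: "_ \<times> 'c"
  proof (rule power2_le_imp_le)
    have "kre (ip_H H (fst z) (fst z)) \<le> K * (norm (fst z))\<^sup>2"
      using K(2)[of "fst z" "fst z"] by (simp add: power2_eq_square mult.commute)
    then have "(norm_XXc H z)\<^sup>2 \<le> K * (norm (fst z))\<^sup>2 + 1 * (norm (snd z))\<^sup>2"
      by (simp add: norm_XXc_squared norm_H_squared[OF sys])
    also have "\<dots> \<le> max K 1 * (norm z)\<^sup>2"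
      unfolding sq distrib_left by (intro add_mono mult_right_mono) auto
    finally show "(norm_XXc H z)\<^sup>2 \<le> (sqrt (max K 1) * norm z)\<^sup>2"
      by (simp add: power_mult_distrib)
  qed (use K in simp)
  have "sqrt (min \<mu> 1) > 0" "sqrt (max K 1) > 0" using \<mu>(1) by auto
  with lower upper show ?thesis by blast
qed

text \<open>
  A bounded Lipschitz trajectory of the system is a solution in \<open>W\<^sup>1\<^sub>\<infinity>(X) \<inter> L\<^sub>\<infinity>(D(\<AA>))\<close>: the
  Lipschitz constant bounds the derivative \<open>\<AA>x\<close>, hence the graph norm.
\<close>

lemma bounded_pH_solutionI:
  assumes sys: "port_hamiltonian N P H"
    and lip: "L-lipschitz_on {0..} x" and bd: "\<And>t. t \<ge> 0 \<Longrightarrow> norm (x t) \<le> B"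
    and E: "negligible E"
    and sol: "\<And>t. t > 0 \<Longrightarrow> t \<notin> E \<Longrightarrow>
      x t \<in> pH_dom N H \<and> (x has_vector_derivative pH_op N P H (x t)) (at t)"
  shows "bounded_pH_solution N P H x"
  unfolding bounded_pH_solution_def
proof (intro exI[of _ "\<lambda>t. pH_op N P H (x t)"] conjI)
  have deriv_bd: "norm (pH_op N P H (x t)) \<le> L" if "t > 0" "t \<notin> E" for t
    using lipschitz_on_derivative_bound[OF lip _ conjunct2[OF sol[OF that]]] that(1) by simp
  show "W1_inf x (\<lambda>t. pH_op N P H (x t))"
    unfolding W1_inf_def
  proof (intro exI[of _ x] exI[of _ "max B L"] conjI)
    show "abs_continuous_halfline x"
      unfolding abs_continuous_halfline_def
      using lipschitz_on_imp_abs_continuous_on[OF lipschitz_on_subset[OF lip]] by simp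
    show "AE t in lebesgue_on {0..}. x t = x t \<and>
       (x has_vector_derivative pH_op N P H (x t)) (at t) \<and>
       norm (x t) \<le> max B L \<and> norm (pH_op N P H (x t)) \<le> max B L"
      using sol bd deriv_bd by (intro AE_halflineI[OF E]) (auto simp: le_max_iff_disj)
  qed
  show "(\<lambda>t. (x t, pH_op N P H (x t))) \<in> borel_measurable (lebesgue_on {0..})"
    by (rule borel_measurable_pair_derivative[OF lipschitz_on_continuous_on[OF lip] E])
       (use sol in blast)
  show "AE t in lebesgue_on {0..}. pH_op N P H (x t) = pH_op N P H (x t)" by simp
  obtain K where K: "K > 0" "\<And>x y. norm (kre (ip_H H x y)) \<le> norm x * norm y * K"
    using bounded_bilinear.pos_bounded[OF bounded_bilinear_energy[OF sys]] by blast
  have norm_le: "(norm_H H y)\<^sup>2 \<le> r\<^sup>2 * K" if "norm y \<le> r" for y r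
  proof -
    have "kre (ip_H H y y) \<le> (norm y)\<^sup>2 * K"
      using K(2)[of y y] by (simp add: power2_eq_square)
    then have "(norm_H H y)\<^sup>2 \<le> (norm y)\<^sup>2 * K" by (simp add: norm_H_squared[OF sys])
    also have "\<dots> \<le> r\<^sup>2 * K" using that K(1) by (intro mult_right_mono power_mono) auto
    finally show ?thesis .
  qed
  show "\<exists>C. AE t in lebesgue_on {0..}. x t \<in> pH_dom N H \<and> graph_norm N P H (x t) \<le> C"
  proof (intro exI[of _ "sqrt (B\<^sup>2 * K + L\<^sup>2 * K)"] AE_halflineI[OF E] conjI)
    fix t assume t: "t > 0" "t \<notin> E"
    show "x t \<in> pH_dom N H" using sol[OF t] by blast
    show "graph_norm N P H (x t) \<le> sqrt (B\<^sup>2 * K + L\<^sup>2 * K)"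
      unfolding graph_norm_def
      using norm_le[OF bd[of t]] norm_le[OF deriv_bd[OF t]] t by (intro real_sqrt_le_mono add_mono) auto
  qed
qed


section \<open>Decay along the orbits\<close>

text \<open>
  Since the input of the system is the output of the controller and vice versa, the power
  \<open>Re (\<BB>x | \<CC>x)\<close> supplied to the system is exactly the term that completes \<open>Re (z\<^sub>c | x\<^sub>c)\<close> to the
  power form of the controller.
\<close>

lemma interconnection_energy_bound:
  assumes imp_passive: "impedance_passive N P H WB WC"
    and ctrl: "\<And>xc uc zc yc. (zc, yc) \<in> Mc (xc, uc) \<Longrightarrow>
        kre (sum_ip ip (zc, yc) (xc, uc)) \<le> - \<rho> * ((norm xc)\<^sup>2 + (norm (Pr uc))\<^sup>2)"
    and z': "z' \<in> interconnection N P H WB WC Mc z"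
  shows "kre (ip_H H (fst z') (fst z)) + kre (ip (snd z') (snd z))
    \<le> - \<rho> * ((norm (snd z))\<^sup>2 + (norm (Pr (boundary_op P H WC (fst z))))\<^sup>2)"
proof -
  let ?B = "boundary_op P H WB (fst z)" and ?C = "boundary_op P H WC (fst z)"
  have *: "fst z \<in> pH_dom N H" "fst z' = pH_op N P H (fst z)" "(snd z', ?B) \<in> Mc (snd z, ?C)"
    using z' by (auto simp: interconnection_def)
  have "kre (ip_H H (fst z') (fst z)) \<le> kre (kip ?B ?C)"
    using imp_passive *(1,2) by (simp add: impedance_passive_def)
  then have "kre (ip_H H (fst z') (fst z)) + kre (ip (snd z') (snd z)) \<le> kre (sum_ip ip (snd z', ?B) (snd z, ?C))"
    by (simp add: sum_ip_def kre_add)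
  also have "\<dots> \<le> - \<rho> * ((norm (snd z))\<^sup>2 + (norm (Pr ?C))\<^sup>2)"
    by (rule ctrl[OF *(3)])
  finally show ?thesis .
qed

lemma energy_has_real_derivative:
  fixes z :: "real \<Rightarrow> ('k::RC_field ^ 'd) L2 \<times> 'c::banach"
    and scale :: "'k \<Rightarrow> 'c \<Rightarrow> 'c" and ip :: "'c \<Rightarrow> 'c \<Rightarrow> 'k"
  assumes sys: "port_hamiltonian N P H" and Xc: "hilbert_space_over scale ip"
    and z: "(z has_vector_derivative z') (at t)"
  shows "((\<lambda>t. (norm_XXc H (z t))\<^sup>2) has_real_derivative
      2 * (kre (ip_H H (fst z') (fst (z t))) + kre (ip (snd z') (snd (z t))))) (at t)"
proof -
  interpret hilbert_space_over scale ip by (rule Xc)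
  have comm: "kre (ip x y) = kre (ip y x)" for x y by (metis ip_commute kre_kcnj)
  have x: "((\<lambda>t. fst (z t)) has_vector_derivative fst z') (at t)"
    and y: "((\<lambda>t. snd (z t)) has_vector_derivative snd z') (at t)"
    using bounded_linear.has_vector_derivative[OF bounded_linear_fst z]
      bounded_linear.has_vector_derivative[OF bounded_linear_snd z] by simp_all
  have eq: "(\<lambda>t. (norm_XXc H (z t))\<^sup>2)
      = (\<lambda>t. kre (ip_H H (fst (z t)) (fst (z t))) + kre (ip (snd (z t)) (snd (z t))))"
    by (simp add: norm_XXc_squared norm_H_squared[OF sys] kre_ip_self)
  show ?thesis
    unfolding eq has_real_derivative_iff_has_vector_derivative
    using has_vector_derivative_add[OF
        bounded_bilinear.has_vector_derivative[OF bounded_bilinear_energy[OF sys] x x]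
        bounded_bilinear.has_vector_derivative[OF bounded_bilinear_kre_ip y y]]
    by (simp add: energy_commute[OF sys, of _ "fst z'"] comm[of _ "snd z'"])
qed

lemma abs_continuous_halfline_energy:
  fixes z :: "real \<Rightarrow> ('k::RC_field ^ 'd) L2 \<times> 'c::banach"
    and scale :: "'k \<Rightarrow> 'c \<Rightarrow> 'c" and ip :: "'c \<Rightarrow> 'c \<Rightarrow> 'k"
  assumes sys: "port_hamiltonian N P H" and Xc: "hilbert_space_over scale ip"
    and z: "abs_continuous_halfline z"
  shows "abs_continuous_halfline (\<lambda>t. (norm_XXc H (z t))\<^sup>2)"
  unfolding abs_continuous_halfline_def
proof (intro allI impI)
  fix T :: real assume "T > 0"
  interpret hilbert_space_over scale ip by (rule Xc)
  have z: "abs_continuous_on 0 T z" using z \<open>T > 0\<close> by (simp add: abs_continuous_halfline_def)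
  have "abs_continuous_on 0 T (\<lambda>t. fst (z t))" "abs_continuous_on 0 T (\<lambda>t. snd (z t))"
    by (rule abs_continuous_on_dominated[OF z z, of _ 1];
        simp add: order_trans[OF dist_fst_le] order_trans[OF dist_snd_le])+
  then have "abs_continuous_on 0 T (\<lambda>t. kre (ip_H H (fst (z t)) (fst (z t))) + kre (ip (snd (z t)) (snd (z t))))"
    by (intro abs_continuous_on_add bounded_bilinear.abs_continuous_on[OF bounded_bilinear_energy[OF sys]]
        bounded_bilinear.abs_continuous_on[OF bounded_bilinear_kre_ip])
  then show "abs_continuous_on 0 T (\<lambda>t. (norm_XXc H (z t))\<^sup>2)"
    by (simp add: norm_XXc_squared norm_H_squared[OF sys] kre_ip_self)
qed

text \<open>
  The conditions on \<open>\<epsilon>\<close> involve neither the orbit nor its initial value, which makes the rate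
  uniform.  Boundedness of the orbit, needed for the inequality for \<open>q\<close>, comes from the
  dissipation of energy alone.
\<close>

lemma orbit_energy_decay:
  fixes z :: "real \<Rightarrow> ('k::RC_field ^ 'd) L2 \<times> 'c::banach"
    and scale :: "'k \<Rightarrow> 'c \<Rightarrow> 'c" and ip :: "'c \<Rightarrow> 'c \<Rightarrow> 'k"
  assumes sys: "port_hamiltonian N P H" and imp_passive: "impedance_passive N P H WB WC"
    and Xc: "hilbert_space_over scale ip"
    and \<rho>: "\<rho> > 0" "\<And>xc uc zc yc. (zc, yc) \<in> Mc (xc, uc) \<Longrightarrow>
        kre (sum_ip ip (zc, yc) (xc, uc)) \<le> - \<rho> * ((norm xc)\<^sup>2 + (norm (Pr uc))\<^sup>2)"
    and c': "\<And>xc uc zc yc. (zc, - yc) \<in> Mc (xc, uc) \<Longrightarrow>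
        (norm yc)\<^sup>2 \<le> c' * ((norm xc)\<^sup>2 + (norm (Pr uc))\<^sup>2)"
    and sol: "inclusion_solution (interconnection N P H WB WC Mc) z0 z"
    and lip: "L-lipschitz_on {0..} z"
    and pos: "c_hat > 0" "c > 0"
    and q_bound: "\<And>x. \<bar>q x\<bar> \<le> c_hat * (norm_H H x)\<^sup>2"
    and q_ineq: "\<And>x. bounded_pH_solution N P H x \<Longrightarrow>
        \<exists>p'. W1_inf (\<lambda>t. q (x t)) p' \<and>
          (AE t in lebesgue_on {0..}. (norm_H H (x t))\<^sup>2 + p' t
             \<le> c * ((norm (boundary_op P H WB (x t)))\<^sup>2 + (norm (Pr (boundary_op P H WC (x t))))\<^sup>2))"
    and \<epsilon>: "\<epsilon> > 0" "\<epsilon> * (c * (c' + 1) + 1) \<le> 2 * \<rho>" "2 * \<epsilon> * c_hat \<le> 1"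
    and T: "T \<ge> 0"
  shows "(norm_XXc H (z T))\<^sup>2 \<le> 3 * exp (- (2 * \<epsilon> / 3) * T) * (norm_XXc H z0)\<^sup>2"
proof -
  define \<phi> where "\<phi> t = (norm_XXc H (z t))\<^sup>2" for t
  define h where "h t = (norm (snd (z t)))\<^sup>2 + (norm (Pr (boundary_op P H WC (fst (z t)))))\<^sup>2" for t
  define D where "D z' t = 2 * (kre (ip_H H (fst z') (fst (z t))) + kre (ip (snd z') (snd (z t))))" for z' t
  have z0: "z 0 = z0" and z_ac: "abs_continuous_halfline z"
    and z_ae: "AE t in lebesgue_on {0..}. \<exists>z'. (z has_vector_derivative z') (at t) \<and>
      z' \<in> interconnection N P H WB WC Mc (z t)"
    using sol by (auto simp: inclusion_solution_def)
  obtain E where E: "negligible E"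
    "\<forall>t\<ge>0. t \<notin> E \<longrightarrow> (\<exists>z'. (z has_vector_derivative z') (at t) \<and> z' \<in> interconnection N P H WB WC Mc (z t))"
    using AE_halfline_imp_negligible[OF z_ae] by blast
  have \<phi>_ac: "abs_continuous_halfline \<phi>"
    unfolding \<phi>_def by (rule abs_continuous_halfline_energy[OF sys Xc z_ac])
  have deriv: "(\<phi> has_real_derivative D z' t) (at t)" if "(z has_vector_derivative z') (at t)" for z' t
    unfolding \<phi>_def D_def by (rule energy_has_real_derivative[OF sys Xc that])
  have D_le: "D z' t \<le> - (2 * \<rho>) * h t" if "z' \<in> interconnection N P H WB WC Mc (z t)" for z' t
    using interconnection_energy_bound[OF imp_passive \<rho>(2) that] by (simp add: D_def h_def)
  have h0: "0 \<le> h t" for t by (simp add: h_def)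
  have \<phi>_le: "\<phi> t \<le> \<phi> 0" if t: "t \<ge> 0" for t
  proof (cases "t > 0")
    case True
    then have ac: "abs_continuous_on 0 t \<phi>" using \<phi>_ac by (simp add: abs_continuous_halfline_def)
    show ?thesis
    proof (rule abs_continuous_on_deriv_nonpos_imp_le[OF ac t E(1)])
      fix s assume "s \<in> {0..t} - E"
      then obtain z' where "(z has_vector_derivative z') (at s)"
        and z': "z' \<in> interconnection N P H WB WC Mc (z s)"
        using E(2) by auto
      then have "(\<phi> has_real_derivative D z' s) (at s)" by (intro deriv)
      moreover have "D z' s \<le> 0"
        using D_le[OF z'] mult_nonneg_nonneg[OF less_imp_le[OF \<rho>(1)] h0[of s]] by linarith
      ultimately show "\<exists>D\<le>0. (\<phi> has_real_derivative D) (at s)" by blast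
    qed
  qed (use t in simp)
  obtain m where m: "m > 0" "\<And>t. m * norm (z t) \<le> norm_XXc H (z t)"
    using norm_XXc_equivalent[OF sys] by blast
  have bd: "norm (fst (z t)) \<le> norm_XXc H z0 / m" if "t \<ge> 0" for t
  proof -
    have "norm_XXc H (z t) \<le> norm_XXc H z0"
      using \<phi>_le[OF that] by (intro power2_le_imp_le[OF _ norm_XXc_nonneg]) (simp add: \<phi>_def z0)
    with m(2)[of t] have "m * norm (z t) \<le> norm_XXc H z0" by linarith
    then have "norm (z t) \<le> norm_XXc H z0 / m" using m(1) by (simp add: field_simps)
    then show ?thesis using norm_fst_le[of "fst (z t)" "snd (z t)"] by simp
  qed
  have "L-lipschitz_on {0..} (\<lambda>t. fst (z t))"
    using lip unfolding lipschitz_on_def by (meson dist_fst_le order_trans)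
  then have x_sol: "bounded_pH_solution N P H (\<lambda>t. fst (z t))"
  proof (rule bounded_pH_solutionI[OF sys _ bd E(1)])
    fix t :: real assume "t > 0" "t \<notin> E"
    then obtain z' where z': "(z has_vector_derivative z') (at t)"
        "z' \<in> interconnection N P H WB WC Mc (z t)"
      using E(2)[rule_format, of t] by auto
    show "fst (z t) \<in> pH_dom N H \<and>
        ((\<lambda>t. fst (z t)) has_vector_derivative pH_op N P H (fst (z t))) (at t)"
      using bounded_linear.has_vector_derivative[OF bounded_linear_fst z'(1)] z'(2)
      by (auto simp: interconnection_def)
  qed
  obtain p' where p': "W1_inf (\<lambda>t. q (fst (z t))) p'"
    "AE t in lebesgue_on {0..}. (norm_H H (fst (z t)))\<^sup>2 + p' t
        \<le> c * ((norm (boundary_op P H WB (fst (z t))))\<^sup>2 + (norm (Pr (boundary_op P H WC (fst (z t)))))\<^sup>2)"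
    using q_ineq[OF x_sol] by blast
  obtain p C where p: "abs_continuous_halfline p"
    "AE t in lebesgue_on {0..}. q (fst (z t)) = p t \<and> (p has_vector_derivative p' t) (at t) \<and>
       norm (q (fst (z t))) \<le> C \<and> norm (p' t) \<le> C"
    using p'(1) unfolding W1_inf_def by blast
  have p_bound: "\<bar>p t\<bar> \<le> c_hat * \<phi> t" if "t \<ge> 0" for t
  proof (rule AE_halfline_le_imp_le[OF _ _ _ that])
    show "continuous_on {0..T} (\<lambda>t. \<bar>p t\<bar>)" "continuous_on {0..T} (\<lambda>t. c_hat * \<phi> t)" for T
      by (intro continuous_intros abs_continuous_halfline_imp_continuous_on p(1) \<phi>_ac)+
    show "AE t in lebesgue_on {0..}. \<bar>p t\<bar> \<le> c_hat * \<phi> t"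
      using p(2)
    proof eventually_elim
      case (elim t)
      then have "\<bar>p t\<bar> \<le> c_hat * (norm_H H (fst (z t)))\<^sup>2" using q_bound[of "fst (z t)"] by simp
      also have "\<dots> \<le> c_hat * \<phi> t" using pos(1) by (simp add: \<phi>_def norm_XXc_squared)
      finally show ?case .
    qed
  qed
  have "\<phi> T \<le> 3 * exp (- (2 * \<epsilon> / 3) * T) * \<phi> 0"
  proof (rule lyapunov_exponential_decay[OF \<phi>_ac p(1) _ p_bound _ \<epsilon> T])
    show "0 \<le> \<phi> t" for t by (simp add: \<phi>_def)
    show "AE t in lebesgue_on {0..}. \<exists>D D' n h. 0 \<le> h \<and> \<phi> t \<le> n + h \<and>
       (\<phi> has_real_derivative D) (at t) \<and> D \<le> - (2 * \<rho>) * h \<and>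
       (p has_real_derivative D') (at t) \<and> n + D' \<le> c * (c' + 1) * h"
      using z_ae p(2) p'(2)
    proof eventually_elim
      case (elim t)
      then obtain z' where z': "(z has_vector_derivative z') (at t)"
        "z' \<in> interconnection N P H WB WC Mc (z t)" by blast
      \<comment> \<open>the output bound is stated for the negated second component\<close>
      have "(snd z', - (- boundary_op P H WB (fst (z t)))) \<in> Mc (snd (z t), boundary_op P H WC (fst (z t)))"
        using z'(2) by (auto simp: interconnection_def)
      from c'[OF this] have "(norm (boundary_op P H WB (fst (z t))))\<^sup>2 \<le> c' * h t"
        by (simp add: h_def)
      moreover have "(norm (Pr (boundary_op P H WC (fst (z t)))))\<^sup>2 \<le> h t" by (simp add: h_def)
      ultimately have "c * ((norm (boundary_op P H WB (fst (z t))))\<^sup>2 + (norm (Pr (boundary_op P H WC (fst (z t)))))\<^sup>2)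
          \<le> c * (c' * h t + h t)"
        using pos(2) by (intro mult_left_mono add_mono) auto
      also have "\<dots> = c * (c' + 1) * h t" by (simp add: algebra_simps)
      finally have "(norm_H H (fst (z t)))\<^sup>2 + p' t \<le> c * (c' + 1) * h t" using elim by linarith
      moreover have "\<phi> t \<le> (norm_H H (fst (z t)))\<^sup>2 + h t"
        by (simp add: \<phi>_def norm_XXc_squared h_def)
      moreover have "(p has_real_derivative p' t) (at t)"
        using elim by (simp add: has_real_derivative_iff_has_vector_derivative)
      ultimately show ?case using h0[of t] deriv[OF z'(1)] D_le[OF z'(2)] by blast
    qed
  qed
  then show ?thesis by (simp add: \<phi>_def z0)
qed

text \<open>
  Both sides of the estimate are continuous in \<open>z\<close>: each \<open>S t\<close> is a contraction for a norm that is
  equivalent to the norm of the type.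
\<close>

lemma contraction_semigroup_extend_bound:
  assumes sys: "port_hamiltonian N P H" and S: "contraction_semigroup (norm_XXc H) Z S"
    and Z: "Z = closure A" and t: "t \<ge> 0"
    and bound: "\<And>z. z \<in> A \<Longrightarrow> norm_XXc H (S t z) \<le> K * norm_XXc H z"
    and z: "z \<in> Z"
  shows "norm_XXc H (S t z) \<le> K * norm_XXc H (z :: _ \<times> 'c::real_normed_vector)"
proof -
  obtain m M where m: "m > 0" "M > 0"
    "\<And>z :: _ \<times> 'c. m * norm z \<le> norm_XXc H z \<and> norm_XXc H z \<le> M * norm z"
    using norm_XXc_equivalent[OF sys] by blast
  have "(M / m)-lipschitz_on Z (S t)"
  proof (rule lipschitz_onI)
    fix x y assume "x \<in> Z" "y \<in> Z"
    then have "norm_XXc H (S t x - S t y) \<le> norm_XXc H (x - y)"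
      using S t by (auto simp: contraction_semigroup_def)
    then have "m * norm (S t x - S t y) \<le> M * norm (x - y)"
      using m(3)[of "S t x - S t y"] m(3)[of "x - y"] by linarith
    then show "dist (S t x) (S t y) \<le> M / m * dist x y"
      using m(1) by (simp add: dist_norm field_simps)
  qed (use m in simp)
  then have cont: "continuous_on Z (S t)" by (rule lipschitz_on_continuous_on)
  have N: "continuous_on B (norm_XXc H :: _ \<times> 'c \<Rightarrow> real)" for B
    by (rule continuous_on_norm_XXc[OF sys])
  have "norm_XXc H (S t z) - K * norm_XXc H z \<le> 0"
  proof (rule continuous_le_on_closure[where S = A and f = "\<lambda>z. norm_XXc H (S t z) - K * norm_XXc H z"])
    show "continuous_on (closure A) (\<lambda>z. norm_XXc H (S t z) - K * norm_XXc H z)"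
      unfolding Z[symmetric]
      by (intro continuous_intros N continuous_on_compose2[OF N[of UNIV] cont]) auto
  qed (use z Z bound in auto)
  then show ?thesis by simp
qed

section \<open>Uniform exponential stability\<close>

theorem proposition7p5:
  fixes N :: nat
    and P :: "nat \<Rightarrow> 'k::RC_field ^ 'd ^ 'd"
    and H :: "real \<Rightarrow> 'k ^ 'd ^ 'd"
    and WB WC :: "'k ^ (('n \<times> 'd) + ('n \<times> 'd)) ^ ('n::{finite,linorder} \<times> 'd)"
    and scale :: "'k \<Rightarrow> 'c::banach \<Rightarrow> 'c"
    and ip :: "'c \<Rightarrow> 'c \<Rightarrow> 'k"
    and Mc :: "'c \<times> ('k ^ ('n \<times> 'd)) \<Rightarrow> ('c \<times> ('k ^ ('n \<times> 'd))) set"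
    and Pr :: "'k ^ ('n \<times> 'd) \<Rightarrow> 'k ^ ('n \<times> 'd)"
    and S :: "real \<Rightarrow> ('k ^ 'd) L2 \<times> 'c \<Rightarrow> ('k ^ 'd) L2 \<times> 'c"
    and q :: "('k ^ 'd) L2 \<Rightarrow> real"
    and c_hat c :: real
  assumes order: "CARD('n) = N"
    and system: "port_hamiltonian N P H"
    and W_inv: "invertible (vec_stack WB WC)"
    and imp_passive: "impedance_passive N P H WB WC"
    and Xc: "hilbert_space_over scale ip"
    and Mc: "m_dissipative (sum_ip ip) Mc"
    and controller: "controller_assumption ip Mc Pr"
    and semigroup: "generates (norm_XXc H) (interconnection N P H WB WC Mc)
                      (UNIV \<times> controller_space Mc) S"
    and constants_pos: "c_hat > 0" "c > 0"
    and q_bound: "\<And>x. \<bar>q x\<bar> \<le> c_hat * (norm_H H x)\<^sup>2"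
    and q_ineq: "\<And>x. bounded_pH_solution N P H x \<Longrightarrow>
        \<exists>p'. W1_inf (\<lambda>t. q (x t)) p' \<and>
          (AE t in lebesgue_on {0..}. (norm_H H (x t))\<^sup>2 + p' t
             \<le> c * ((norm (boundary_op P H WB (x t)))\<^sup>2 + (norm (Pr (boundary_op P H WC (x t))))\<^sup>2))"
  shows "\<exists>M\<ge>1. \<exists>\<omega><0. \<forall>z\<in>UNIV \<times> controller_space Mc. \<forall>t\<ge>0.
           norm_XXc H (S t z) \<le> M * exp (\<omega> * t) * norm_XXc H z"
proof -
  obtain \<rho> where \<rho>: "\<rho> > 0" "\<And>xc uc zc yc. (zc, yc) \<in> Mc (xc, uc) \<Longrightarrow>
      kre (sum_ip ip (zc, yc) (xc, uc)) \<le> - \<rho> * ((norm xc)\<^sup>2 + (norm (Pr uc))\<^sup>2)"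
    using controller unfolding controller_assumption_def by blast
  obtain c' where c': "c' > 0" "\<And>xc uc zc yc. (zc, - yc) \<in> Mc (xc, uc) \<Longrightarrow>
      (norm yc)\<^sup>2 \<le> c' * ((norm xc)\<^sup>2 + (norm (Pr uc))\<^sup>2)"
    using controller unfolding controller_assumption_def by blast
  let ?A = "interconnection N P H WB WC Mc"
  define b where "b = c * (c' + 1) + 1"
  have b: "b > 0" using constants_pos c'(1) by (simp add: b_def add_pos_pos)
  \<comment> \<open>the first bound makes the Lyapunov function decrease, the second keeps it comparable with
    the energy\<close>
  define \<epsilon> where "\<epsilon> = min (2 * \<rho> / b) (1 / (2 * c_hat))"
  have \<epsilon>: "\<epsilon> > 0" using \<rho>(1) b constants_pos by (simp add: \<epsilon>_def)
  have "\<epsilon> \<le> 2 * \<rho> / b" "\<epsilon> \<le> 1 / (2 * c_hat)" by (simp_all add: \<epsilon>_def)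
  then have \<epsilon>_b: "\<epsilon> * (c * (c' + 1) + 1) \<le> 2 * \<rho>" and \<epsilon>_c: "2 * \<epsilon> * c_hat \<le> 1"
    unfolding b_def[symmetric] using b constants_pos by (simp_all add: field_simps)
  have closure: "UNIV \<times> controller_space Mc = closure (mdom ?A)"
    and contraction: "contraction_semigroup (norm_XXc H) (UNIV \<times> controller_space Mc) S"
    and orbit: "\<And>z0. z0 \<in> mdom ?A \<Longrightarrow> inclusion_solution ?A z0 (\<lambda>t. S t z0)"
    and lip: "\<And>z0. z0 \<in> mdom ?A \<Longrightarrow> \<exists>L. L-lipschitz_on {0..} (\<lambda>t. S t z0)"
    using semigroup unfolding generates_def by blast+
  have decay: "norm_XXc H (S t z0) \<le> sqrt 3 * exp (- (\<epsilon> / 3) * t) * norm_XXc H z0"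
    if z0: "z0 \<in> mdom ?A" and t: "t \<ge> 0" for z0 t
  proof (rule power2_le_imp_le)
    obtain L where "L-lipschitz_on {0..} (\<lambda>t. S t z0)" using lip[OF z0] by blast
    from orbit_energy_decay[OF system imp_passive Xc \<rho> c'(2) orbit[OF z0] this constants_pos
        q_bound q_ineq \<epsilon> \<epsilon>_b \<epsilon>_c t]
    have "(norm_XXc H (S t z0))\<^sup>2 \<le> 3 * exp (- (2 * \<epsilon> / 3) * t) * (norm_XXc H z0)\<^sup>2" .
    also have "exp (- (2 * \<epsilon> / 3) * t) = (exp (- (\<epsilon> / 3) * t))\<^sup>2"
      by (simp add: power2_eq_square flip: exp_add)
    finally show "(norm_XXc H (S t z0))\<^sup>2 \<le> (sqrt 3 * exp (- (\<epsilon> / 3) * t) * norm_XXc H z0)\<^sup>2"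
      by (simp add: power_mult_distrib)
  qed (simp add: norm_XXc_nonneg)
  show ?thesis
  proof (rule exI[of _ "sqrt 3"], rule conjI, simp, rule exI[of _ "- (\<epsilon> / 3)"], rule conjI)
    show "- (\<epsilon> / 3) < 0" using \<epsilon> by simp
    show "\<forall>z\<in>UNIV \<times> controller_space Mc. \<forall>t\<ge>0.
        norm_XXc H (S t z) \<le> sqrt 3 * exp (- (\<epsilon> / 3) * t) * norm_XXc H z"
      using contraction_semigroup_extend_bound[OF system contraction closure _ decay] by blast
  qed
qed

end
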